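(* Let $D$ be a defeasible theory, let $S_D$ and $S^*_D$ be its compiled programs, and let $q(\vec a)$ be a ground literal ($q$ has the form $p$ or $\neg p$ in $D$, written $\mathtt{p}$ or $\mathtt{not\_p}$ in the programs). Then $\mathcal M_{\partial_{||}}(D)\models_{WF}\mathtt{definitely}(q(\vec a))$ iff $S_D\models_{WF}\mathtt{definitely\_q}(\vec a)$; $\mathcal M_{\partial_{||}}(D)\models_{WF}\mathtt{lambda}(q(\vec a))$ iff $S_D\models_{WF}\mathtt{lambda\_q}(\vec a)$; $\mathcal M_{\partial_{||}}(D)\models_{WF}\mathtt{defeasibly}(q(\vec a))$ iff $S_D\models_{WF}\mathtt{defeasibly\_q}(\vec a)$; and the same three equivalences hold with $\mathcal M_{\partial^*_{||}}(D)$ in place of $\mathcal M_{\partial_{||}}(D)$ and $S^*_D$ in place of $S_D$.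
   Context: Defeasible theories. A literal is an atom $p(t_1,\dots,t_n)$ or its classical negation $\neg p(t_1,\dots,t_n)$; ${\sim}q$ is the complementary literal. A defeasible theory $D=(F,R,>)$ consists of a finite set $F$ of variable-free literals (facts), a finite set $R$ of labelled rules $r$ with antecedent set $A(r)$, consequent $C(r)$ and kind strict ($\to$), defeasible ($\Rightarrow$) or defeater ($\leadsto$), and an acyclic superiority relation $>$ on labels. Metaprograms. $D$ is represented by unit clauses $\mathtt{fact}(q)$ ($q\in F$), $\mathtt{strict}(r,q,[q_1,\dots,q_n])$, $\mathtt{defeasible}(r,q,[q_1,\dots,q_n])$, $\mathtt{defeater}(r,q,[q_1,\dots,q_n])$ (rules $r:q_1,\dots,q_n\hookrightarrow q$ of the respective kind), $\mathtt{sup}(r,s)$ ($r>s$); predicates of $D$ become function symbols and $\neg p(\vec t)$ is written $\mathtt{not\_p}(\vec t)$; for each predicate $p$, also $\mathtt{neg}(\mathtt{p}(\vec X),\mathtt{not\_p}(\vec X))$ and $\mathtt{neg}(\mathtt{not\_p}(\vec X),\mathtt{p}(\vec X))$. $\mathcal M_{\partial_{||}}(D)$ is this with: $\mathtt{rule}(R,H,B)\,\text{:-}\,\mathtt{strict\_or\_defeasible}(R,H,B)$; $\mathtt{rule}(R,H,B)\,\text{:-}\,\mathtt{defeater}(R,H,B)$; $\mathtt{strict\_or\_defeasible}(R,H,B)\,\text{:-}\,\mathtt{strict}(R,H,B)$; $\mathtt{strict\_or\_defeasible}(R,H,B)\,\text{:-}\,\mathtt{defeasible}(R,H,B)$; for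 $\tau\in\{\mathtt{definitely},\mathtt{lambda},\mathtt{defeasibly}\}$: $\mathtt{loop\_}\tau([\,])$, $\mathtt{loop\_}\tau([H|T])\,\text{:-}\,\tau(H),\mathtt{loop\_}\tau(T)$; $\mathtt{definitely}(X)\,\text{:-}\,\mathtt{fact}(X)$; $\mathtt{definitely}(X)\,\text{:-}\,\mathtt{strict}(R,X,Y),\mathtt{loop\_definitely}(Y)$; $\mathtt{lambda}(X)\,\text{:-}\,\mathtt{definitely}(X)$; $\mathtt{lambda}(X)\,\text{:-}\,\mathtt{neg}(X,X'),\ not\ \mathtt{definitely}(X'),\ \mathtt{strict\_or\_defeasible}(R,X,Y),\ \mathtt{loop\_lambda}(Y)$; $\mathtt{defeasibly}(X)\,\text{:-}\,\mathtt{definitely}(X)$; $\mathtt{defeasibly}(X)\,\text{:-}\,\mathtt{neg}(X,X'),\ not\ \mathtt{definitely}(X'),\ \mathtt{strict\_or\_defeasible}(R,X,Y),\ \mathtt{loop\_defeasibly}(Y),\ not\ \mathtt{overruled}(X)$; $\mathtt{overruled}(X)\,\text{:-}\,\mathtt{neg}(X,X'),\ \mathtt{rule}(S,X',U),\ \mathtt{loop\_lambda}(U),\ not\ \mathtt{defeated}(S,X')$; $\mathtt{defeated}(S,X')\,\text{:-}\,\mathtt{neg}(X,X'),\ \mathtt{sup}(T,S),\ \mathtt{strict\_or\_defeasible}(T,X,V),\ \mathtt{loop\_defeasibly}(V)$. $\mathcal M_{\partial^*_{||}}(D)$ is identical except its last three clauses are replaced by: $\mathtt{defeasibly}(X)\,\text{:-}\,\mathtt{neg}(X,X'),\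 not\ \mathtt{definitely}(X'),\ \mathtt{strict\_or\_defeasible}(R,X,Y),\ \mathtt{loop\_defeasibly}(Y),\ not\ \mathtt{overruled}(R,X)$; $\mathtt{overruled}(R,X)\,\text{:-}\,\mathtt{neg}(X,X'),\ \mathtt{rule}(S,X',U),\ \mathtt{loop\_lambda}(U),\ not\ \mathtt{defeats}(R,S)$; $\mathtt{defeats}(R,S)\,\text{:-}\,\mathtt{sup}(R,S)$. Compiled programs. For a literal $q$ with predicate $p$, $\mathtt{q}$ denotes $\mathtt{p}$ if $q$ is positive and $\mathtt{not\_p}$ if negative; $\mathtt{{\sim}q}$ is the name of the complement; predicate names are formed by concatenation; rule labels are constants. $S_D$ consists exactly of: (i) for each fact $q(\vec a)$: unit clauses $\mathtt{definitely\_q}(\vec a)$, $\mathtt{lambda\_q}(\vec a)$, $\mathtt{defeasibly\_q}(\vec a)$; (ii) for each strict rule $r:q_1(\vec a_1),\dots,q_n(\vec a_n)\to q(\vec a)$: $\mathtt{definitely\_q}(\vec a)\,\text{:-}\,\mathtt{body}^\Delta_r(\vec a)$, $\mathtt{lambda\_q}(\vec a)\,\text{:-}\,\mathtt{body}^\Delta_r(\vec a)$, $\mathtt{defeasibly\_q}(\vec a)\,\text{:-}\,\mathtt{body}^\Delta_r(\vec a)$, $\mathtt{body}^\Delta_r(\vec a)\,\text{:-}\,\mathtt{definitely\_q_1}(\vec a_1),\dots,\mathtt{definitely\_q_n}(\vec a_n)$; (iii) for each strict or defeasible rule $r:q_1(\vec a_1),\dots,q_n(\vec a_n)\hookrightarrow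 q(\vec a)$: $\mathtt{lambda\_q}(\vec a)\,\text{:-}\,not\ \mathtt{definitely\_{\sim}q}(\vec a),\mathtt{body}^\lambda_r(\vec a)$ and $\mathtt{defeasibly\_q}(\vec a)\,\text{:-}\,not\ \mathtt{definitely\_{\sim}q}(\vec a),\mathtt{body}^d_r(\vec a),not\ \mathtt{overruled\_q}(\vec a)$; (iv) for each rule $s$ of any kind, $s:q_1(\vec a_1),\dots,q_n(\vec a_n)\hookrightarrow q(\vec a)$: $\mathtt{body}^\lambda_s(\vec a)\,\text{:-}\,\mathtt{lambda\_q_1}(\vec a_1),\dots,\mathtt{lambda\_q_n}(\vec a_n)$, $\mathtt{body}^d_s(\vec a)\,\text{:-}\,\mathtt{defeasibly\_q_1}(\vec a_1),\dots,\mathtt{defeasibly\_q_n}(\vec a_n)$, $\mathtt{overruled\_{\sim}q}(\vec a)\,\text{:-}\,\mathtt{body}^\lambda_s(\vec a),not\ \mathtt{defeated\_q}(s,\vec a)$; (v) for each strict or defeasible rule $t$ with consequent $q(\vec a)$ and each rule $s$ with consequent of the form ${\sim}q(\dots)$ with $t>s$: $\mathtt{defeated\_{\sim}q}(s,\vec a)\,\text{:-}\,\mathtt{body}^d_t(\vec a)$. $S^*_D$ is the same as $S_D$ except that the $\mathtt{defeasibly\_q}$ clauses of (iii), the $\mathtt{overruled}$ clauses of (iv) and the clauses of (v) are replaced by: for each strict or defeasible rule $r$ with consequent $q(\vec a)$, $\mathtt{defeasibly\_q}(\vec a)\,\text{:-}\,not\ \mathtt{definitely\_{\sim}q}(\vec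 a),\mathtt{body}^d_r(\vec a),not\ \mathtt{overruled\_q}(r,\vec a)$; for each such $r$ and each rule $s$ with consequent ${\sim}q(\vec b)$, $\mathtt{overruled\_q}(r,\vec b)\,\text{:-}\,\mathtt{body}^\lambda_s(\vec b),not\ \mathtt{defeats\_q}(r,s)$; for each $r>s$ with $r$ having consequent literal $q$, the unit clause $\mathtt{defeats\_q}(r,s)$. $P\models_{WF}\ell$ means the ground literal $\ell$ holds in the well-founded model of the logic program $P$. *)

theory Defs
  imports Main
begin

section \<open>Normal logic programs and the well-founded model\<close>

datatype ('g, 'v) trm = Var 'v | Fun 'g "('g, 'v) trm list"

fun subst :: "('v \<Rightarrow> ('g, 'v) trm) \<Rightarrow> ('g, 'v) trm \<Rightarrow> ('g, 'v) trm" where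
  "subst \<sigma> (Var x) = \<sigma> x"
| "subst \<sigma> (Fun f ts) = Fun f (map (subst \<sigma>) ts)"

fun vars :: "('g, 'v) trm \<Rightarrow> 'v set" where
  "vars (Var x) = {x}"
| "vars (Fun f ts) = (\<Union>t\<in>set ts. vars t)"

text \<open>As in Prolog, a symbol is identified by its name together with its arity, so a signature
  is a set of pairs (name, arity).\<close>

fun funs :: "('g, 'v) trm \<Rightarrow> ('g \<times> nat) set" where
  "funs (Var x) = {}"
| "funs (Fun f ts) = insert (f, length ts) (\<Union>t\<in>set ts. funs t)"

inductive_set herbrand_universe :: "('g \<times> nat) set \<Rightarrow> ('g, 'v) trm set"
  for \<Sigma> :: "('g \<times> nat) set" where
  "(f, length ts) \<in> \<Sigma> \<Longrightarrow> \<forall>t\<in>set ts. t \<in> herbrand_universe \<Sigma>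
     \<Longrightarrow> Fun f ts \<in> herbrand_universe \<Sigma>"

datatype ('q, atom_args: 't) atom = Atom 'q "'t list"

datatype 'a naf_lit = Pos 'a | Naf 'a

fun naf_compl :: "'a naf_lit \<Rightarrow> 'a naf_lit" where
  "naf_compl (Pos A) = Naf A"
| "naf_compl (Naf A) = Pos A"

text \<open>\<^term>\<open>clause_args c\<close> is the set of all terms that occur as an argument of some atom in
  the head or the body of \<open>c\<close>.\<close>

datatype ('q, clause_args: 't) clause =
  Clause (head: "('q, 't) atom") (body: "('q, 't) atom naf_lit list")  (infix "\<longleftarrow>" 50)

type_synonym ('q, 'g, 'v) program = "('q, ('g, 'v) trm) clause set"

definition prog_funs :: "('q, 'g, 'v) program \<Rightarrow> ('g \<times> nat) set" where
  "prog_funs P = (\<Union>c\<in>P. \<Union>t\<in>clause_args c. funs t)"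

definition herbrand_base :: "('g \<times> nat) set \<Rightarrow> ('q, ('g, 'v) trm) atom set" where
  "herbrand_base \<Sigma> = {A. atom_args A \<subseteq> herbrand_universe \<Sigma>}"

definition ground_instances ::
  "('g \<times> nat) set \<Rightarrow> ('q, 'g, 'v) program \<Rightarrow> ('q, 'g, 'v) program" where
  "ground_instances \<Sigma> P =
     {map_clause id (subst \<sigma>) c | c \<sigma>.
        c \<in> P \<and> clause_args (map_clause id (subst \<sigma>) c) \<subseteq> herbrand_universe \<Sigma>}"

text \<open>The well-founded model in the original style of Van Gelder, Ross and Schlipf. A partial
  interpretation is a set of ground literals; atoms about which it is silent are undefined.\<close>

definition immediate_conseq ::
  "('g \<times> nat) set \<Rightarrow> ('q, 'g, 'v) program \<Rightarrow> ('q, ('g, 'v) trm) atom naf_lit set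
     \<Rightarrow> ('q, ('g, 'v) trm) atom set" where
  "immediate_conseq \<Sigma> P I = {head c | c. c \<in> ground_instances \<Sigma> P \<and> set (body c) \<subseteq> I}"

definition unfounded ::
  "('g \<times> nat) set \<Rightarrow> ('q, 'g, 'v) program \<Rightarrow> ('q, ('g, 'v) trm) atom naf_lit set
     \<Rightarrow> ('q, ('g, 'v) trm) atom set \<Rightarrow> bool" where
  "unfounded \<Sigma> P I U \<longleftrightarrow>
     U \<subseteq> herbrand_base \<Sigma> \<and>
     (\<forall>c\<in>ground_instances \<Sigma> P. head c \<in> U \<longrightarrow>
        (\<exists>l\<in>set (body c). naf_compl l \<in> I \<or> l \<in> Pos ` U))"

definition wf_step ::
  "('g \<times> nat) set \<Rightarrow> ('q, 'g, 'v) program \<Rightarrow> ('q, ('g, 'v) trm) atom naf_lit set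
     \<Rightarrow> ('q, ('g, 'v) trm) atom naf_lit set" where
  "wf_step \<Sigma> P I = Pos ` immediate_conseq \<Sigma> P I \<union> Naf ` \<Union> {U. unfounded \<Sigma> P I U}"

lemma mono_wf_step: "mono (wf_step \<Sigma> P)"
proof (rule monoI)
  fix I J :: "('a, ('b, 'c) trm) atom naf_lit set"
  assume "I \<subseteq> J"
  then have "immediate_conseq \<Sigma> P I \<subseteq> immediate_conseq \<Sigma> P J"
    unfolding immediate_conseq_def by blast
  moreover from \<open>I \<subseteq> J\<close> have "unfounded \<Sigma> P I U \<Longrightarrow> unfounded \<Sigma> P J U" for U
    unfolding unfounded_def by blast
  ultimately show "wf_step \<Sigma> P I \<subseteq> wf_step \<Sigma> P J"
    unfolding wf_step_def by blast
qed

definition wf_model ::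
  "('g \<times> nat) set \<Rightarrow> ('q, 'g, 'v) program \<Rightarrow> ('q, ('g, 'v) trm) atom naf_lit set" where
  "wf_model \<Sigma> P = lfp (wf_step \<Sigma> P)"

definition wf_entails ::
  "('q, 'g, 'v) program \<Rightarrow> ('g \<times> nat) set \<Rightarrow> ('q, ('g, 'v) trm) atom naf_lit \<Rightarrow> bool"
  ("_ \<Turnstile>\<^sub>W\<^sub>F[_] _" [51, 0, 51] 50) where
  "P \<Turnstile>\<^sub>W\<^sub>F[\<Sigma>] l \<longleftrightarrow> l \<in> wf_model \<Sigma> P"

section \<open>Defeasible theories\<close>

text \<open>A signed predicate \<open>q\<close> is \<open>p\<close> or \<open>\<not>p\<close>; it also serves as the name \<open>p\<close> or \<open>not_p\<close> in the
  programs.\<close>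

datatype 'p spred = Pr (pred: 'p) | NotPr (pred: 'p)

fun compl :: "'p spred \<Rightarrow> 'p spred" where
  "compl (Pr p) = NotPr p"
| "compl (NotPr p) = Pr p"

datatype ('f, 'p) lit = Lit (spred: "'p spred") (args: "('f, nat) trm list")

definition ground_lit :: "('f, 'p) lit \<Rightarrow> bool" where
  "ground_lit l \<longleftrightarrow> (\<forall>t\<in>set (args l). vars t = {})"

datatype rule_kind = Strict | Defeasible | Defeater

text \<open>The antecedent set of a rule \<open>r\<close> is \<open>set (ants r)\<close>; the list fixes the order in which it is
  written.\<close>

datatype ('f, 'p, 'l) rule =
  Rule (label: 'l) (kind: rule_kind) (ants: "('f, 'p) lit list") (conseq: "('f, 'p) lit")

text \<open>\<open>(r, s) \<in> superior D\<close> means \<open>r > s\<close>.\<close>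

record ('f, 'p, 'l) dtheory =
  facts :: "('f, 'p) lit set"
  rules :: "('f, 'p, 'l) rule set"
  superior :: "('l \<times> 'l) set"

definition defeasible_theory :: "('f, 'p, 'l) dtheory \<Rightarrow> bool" where
  "defeasible_theory D \<longleftrightarrow>
     finite (facts D) \<and> (\<forall>l\<in>facts D. ground_lit l) \<and>
     finite (rules D) \<and> inj_on label (rules D) \<and>
     superior D \<subseteq> label ` rules D \<times> label ` rules D \<and> acyclic (superior D)"

definition sd_rules :: "('f, 'p, 'l) dtheory \<Rightarrow> ('f, 'p, 'l) rule set" where
  "sd_rules D = {r \<in> rules D. kind r = Strict \<or> kind r = Defeasible}"

definition dtheory_lits :: "('f, 'p, 'l) dtheory \<Rightarrow> ('f, 'p) lit set" where
  "dtheory_lits D = facts D \<union> (\<Union>r\<in>rules D. insert (conseq r) (set (ants r)))"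

definition dtheory_preds :: "('f, 'p, 'l) dtheory \<Rightarrow> ('p \<times> nat) set" where
  "dtheory_preds D = {(pred (spred l), length (args l)) | l. l \<in> dtheory_lits D}"

section \<open>The common term language of the programs\<close>

text \<open>The programs compared with each other are evaluated over the ground terms of one common
  signature. With the separate Herbrand universes of the individual programs they would not be
  equivalent: the universe of a metaprogram is infinite because of its lists, that of a compiled
  program may be finite, and rules such as \<open>\<rightarrow> \<not>e(X,X)\<close>, \<open>\<Rightarrow> e(X,Y)\<close> and
  \<open>e(X,Y), e(X,Z), e(X,W), e(Y,Z), e(Y,W), e(Z,W) \<Rightarrow> p\<close> count the elements. The constructors keep
  function symbols, (signed) predicates, labels and list symbols apart.\<close>

datatype ('f, 'p, 'l) sym = Fn 'f | SPred "'p spred" | Label 'l | NilSym | ConsSym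

type_synonym ('f, 'p, 'l) pterm = "(('f, 'p, 'l) sym, nat) trm"

definition emb :: "('f, nat) trm \<Rightarrow> ('f, 'p, 'l) pterm" where
  "emb = map_trm Fn id"

definition label_term :: "'l \<Rightarrow> ('f, 'p, 'l) pterm" where
  "label_term r = Fun (Label r) []"

definition lit_term :: "('f, 'p) lit \<Rightarrow> ('f, 'p, 'l) pterm" where
  "lit_term l = Fun (SPred (spred l)) (map emb (args l))"

definition nil_term :: "('f, 'p, 'l) pterm" where
  "nil_term = Fun NilSym []"

definition cons_term :: "('f, 'p, 'l) pterm \<Rightarrow> ('f, 'p, 'l) pterm \<Rightarrow> ('f, 'p, 'l) pterm" where
  "cons_term h t = Fun ConsSym [h, t]"

definition list_term :: "('f, 'p, 'l) pterm list \<Rightarrow> ('f, 'p, 'l) pterm" where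
  "list_term ts = foldr cons_term ts nil_term"

datatype tag = Definitely | Lambda | Defeasibly

section \<open>Metaprograms\<close>

text \<open>\<open>RuleFact k\<close> is \<open>strict\<close>, \<open>defeasible\<close> or \<open>defeater\<close>; \<open>Holds \<tau>\<close> and \<open>Loop \<tau>\<close> are \<open>\<tau>\<close> and
  \<open>loop_\<tau>\<close>. \<open>MOverruled\<close> is used with one argument in the first program and with two in the
  second.\<close>

datatype mpred =
  Fact | RuleFact rule_kind | Sup | Neg | AnyRule | StrictOrDefeasible
| Holds tag | Loop tag | MOverruled | MDefeated | MDefeats

abbreviation vX :: "('f, 'p, 'l) pterm" where "vX \<equiv> Var 0"
abbreviation vX' :: "('f, 'p, 'l) pterm" where "vX' \<equiv> Var 1"
abbreviation vY :: "('f, 'p, 'l) pterm" where "vY \<equiv> Var 2"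
abbreviation vR :: "('f, 'p, 'l) pterm" where "vR \<equiv> Var 3"
abbreviation vS :: "('f, 'p, 'l) pterm" where "vS \<equiv> Var 4"
abbreviation vT :: "('f, 'p, 'l) pterm" where "vT \<equiv> Var 5"
abbreviation vU :: "('f, 'p, 'l) pterm" where "vU \<equiv> Var 6"
abbreviation vV :: "('f, 'p, 'l) pterm" where "vV \<equiv> Var 7"
abbreviation vH :: "('f, 'p, 'l) pterm" where "vH \<equiv> Var 8"
abbreviation vB :: "('f, 'p, 'l) pterm" where "vB \<equiv> Var 9"

definition spred_vars :: "'p spred \<Rightarrow> nat \<Rightarrow> ('f, 'p, 'l) pterm" where
  "spred_vars q n = Fun (SPred q) (map Var [0..<n])"

definition theory_clauses ::
  "('f, 'p, 'l) dtheory \<Rightarrow> (mpred, ('f, 'p, 'l) sym, nat) program" where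
  "theory_clauses D =
     {Atom Fact [lit_term q] \<longleftarrow> [] | q. q \<in> facts D}
   \<union> {Atom (RuleFact (kind r))
        [label_term (label r), lit_term (conseq r), list_term (map lit_term (ants r))] \<longleftarrow> []
      | r. r \<in> rules D}
   \<union> {Atom Sup [label_term r, label_term s] \<longleftarrow> [] | r s. (r, s) \<in> superior D}
   \<union> {Atom Neg [spred_vars (Pr p) n, spred_vars (NotPr p) n] \<longleftarrow> []
      | p n. (p, n) \<in> dtheory_preds D}
   \<union> {Atom Neg [spred_vars (NotPr p) n, spred_vars (Pr p) n] \<longleftarrow> []
      | p n. (p, n) \<in> dtheory_preds D}"

definition meta_common :: "(mpred, ('f, 'p, 'l) sym, nat) program" where
  "meta_common =
     {Atom AnyRule [vR, vH, vB] \<longleftarrow> [Pos (Atom StrictOrDefeasible [vR, vH, vB])],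
      Atom AnyRule [vR, vH, vB] \<longleftarrow> [Pos (Atom (RuleFact Defeater) [vR, vH, vB])],
      Atom StrictOrDefeasible [vR, vH, vB] \<longleftarrow> [Pos (Atom (RuleFact Strict) [vR, vH, vB])],
      Atom StrictOrDefeasible [vR, vH, vB] \<longleftarrow> [Pos (Atom (RuleFact Defeasible) [vR, vH, vB])]}
   \<union> {Atom (Loop \<tau>) [nil_term] \<longleftarrow> [] | \<tau>. True}
   \<union> {Atom (Loop \<tau>) [cons_term vH vT] \<longleftarrow>
        [Pos (Atom (Holds \<tau>) [vH]), Pos (Atom (Loop \<tau>) [vT])] | \<tau>. True}
   \<union> {Atom (Holds Definitely) [vX] \<longleftarrow> [Pos (Atom Fact [vX])],
      Atom (Holds Definitely) [vX] \<longleftarrow>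
        [Pos (Atom (RuleFact Strict) [vR, vX, vY]), Pos (Atom (Loop Definitely) [vY])],
      Atom (Holds Lambda) [vX] \<longleftarrow> [Pos (Atom (Holds Definitely) [vX])],
      Atom (Holds Lambda) [vX] \<longleftarrow>
        [Pos (Atom Neg [vX, vX']), Naf (Atom (Holds Definitely) [vX']),
         Pos (Atom StrictOrDefeasible [vR, vX, vY]), Pos (Atom (Loop Lambda) [vY])],
      Atom (Holds Defeasibly) [vX] \<longleftarrow> [Pos (Atom (Holds Definitely) [vX])]}"

definition meta_par ::
  "('f, 'p, 'l) dtheory \<Rightarrow> (mpred, ('f, 'p, 'l) sym, nat) program" where
  "meta_par D = theory_clauses D \<union> meta_common \<union>
     {Atom (Holds Defeasibly) [vX] \<longleftarrow>
        [Pos (Atom Neg [vX, vX']), Naf (Atom (Holds Definitely) [vX']),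
         Pos (Atom StrictOrDefeasible [vR, vX, vY]), Pos (Atom (Loop Defeasibly) [vY]),
         Naf (Atom MOverruled [vX])],
      Atom MOverruled [vX] \<longleftarrow>
        [Pos (Atom Neg [vX, vX']), Pos (Atom AnyRule [vS, vX', vU]),
         Pos (Atom (Loop Lambda) [vU]), Naf (Atom MDefeated [vS, vX'])],
      Atom MDefeated [vS, vX'] \<longleftarrow>
        [Pos (Atom Neg [vX, vX']), Pos (Atom Sup [vT, vS]),
         Pos (Atom StrictOrDefeasible [vT, vX, vV]), Pos (Atom (Loop Defeasibly) [vV])]}"

definition meta_par_star ::
  "('f, 'p, 'l) dtheory \<Rightarrow> (mpred, ('f, 'p, 'l) sym, nat) program" where
  "meta_par_star D = theory_clauses D \<union> meta_common \<union>
     {Atom (Holds Defeasibly) [vX] \<longleftarrow>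
        [Pos (Atom Neg [vX, vX']), Naf (Atom (Holds Definitely) [vX']),
         Pos (Atom StrictOrDefeasible [vR, vX, vY]), Pos (Atom (Loop Defeasibly) [vY]),
         Naf (Atom MOverruled [vR, vX])],
      Atom MOverruled [vR, vX] \<longleftarrow>
        [Pos (Atom Neg [vX, vX']), Pos (Atom AnyRule [vS, vX', vU]),
         Pos (Atom (Loop Lambda) [vU]), Naf (Atom MDefeats [vR, vS])],
      Atom MDefeats [vR, vS] \<longleftarrow> [Pos (Atom Sup [vR, vS])]}"

section \<open>Compiled programs\<close>

text \<open>\<open>HoldsC \<tau> q\<close> is the predicate \<open>\<tau>_q\<close>. \<open>Body \<tau> r\<close> is the predicate \<open>body\<^sup>\<Delta>\<^sub>r\<close>, \<open>body\<^sup>\<lambda>\<^sub>r\<close> or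
  \<open>body\<^sup>d\<^sub>r\<close> according as \<open>\<tau>\<close> is \<open>Definitely\<close>, \<open>Lambda\<close> or \<open>Defeasibly\<close>.\<close>

datatype ('p, 'l) cpred =
  HoldsC tag "'p spred" | Body tag 'l
| Overruled "'p spred" | Defeated "'p spred" | Defeats "'p spred"

abbreviation pargs :: "('f, 'p) lit \<Rightarrow> ('f, 'p, 'l) pterm list" where
  "pargs l \<equiv> map emb (args l)"

definition holds_atom :: "tag \<Rightarrow> ('f, 'p) lit \<Rightarrow> (('p, 'l) cpred, ('f, 'p, 'l) pterm) atom" where
  "holds_atom \<tau> l = Atom (HoldsC \<tau> (spred l)) (pargs l)"

definition body_atom ::
  "tag \<Rightarrow> ('f, 'p, 'l) rule \<Rightarrow> (('p, 'l) cpred, ('f, 'p, 'l) pterm) atom" where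
  "body_atom \<tau> r = Atom (Body \<tau> (label r)) (pargs (conseq r))"

definition compl_lit :: "('f, 'p) lit \<Rightarrow> ('f, 'p) lit" where
  "compl_lit l = Lit (compl (spred l)) (args l)"

definition body_clause ::
  "tag \<Rightarrow> ('f, 'p, 'l) rule \<Rightarrow> (('p, 'l) cpred, ('f, 'p, 'l) pterm) clause" where
  "body_clause \<tau> r = (body_atom \<tau> r \<longleftarrow> map (\<lambda>l. Pos (holds_atom \<tau> l)) (ants r))"

definition compiled_common ::
  "('f, 'p, 'l) dtheory \<Rightarrow> (('p, 'l) cpred, ('f, 'p, 'l) sym, nat) program" where
  "compiled_common D =
     {holds_atom \<tau> l \<longleftarrow> [] | \<tau> l. l \<in> facts D}
   \<union> {holds_atom \<tau> (conseq r) \<longleftarrow> [Pos (body_atom Definitely r)]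
      | \<tau> r. r \<in> rules D \<and> kind r = Strict}
   \<union> {body_clause Definitely r | r. r \<in> rules D \<and> kind r = Strict}
   \<union> {holds_atom Lambda (conseq r) \<longleftarrow>
        [Naf (holds_atom Definitely (compl_lit (conseq r))), Pos (body_atom Lambda r)]
      | r. r \<in> sd_rules D}
   \<union> {body_clause Lambda s | s. s \<in> rules D}
   \<union> {body_clause Defeasibly s | s. s \<in> rules D}"

definition compiled ::
  "('f, 'p, 'l) dtheory \<Rightarrow> (('p, 'l) cpred, ('f, 'p, 'l) sym, nat) program" where
  "compiled D = compiled_common D
   \<union> {holds_atom Defeasibly (conseq r) \<longleftarrow>
        [Naf (holds_atom Definitely (compl_lit (conseq r))), Pos (body_atom Defeasibly r),
         Naf (Atom (Overruled (spred (conseq r))) (pargs (conseq r)))]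
      | r. r \<in> sd_rules D}
   \<union> {Atom (Overruled (compl (spred (conseq s)))) (pargs (conseq s)) \<longleftarrow>
        [Pos (body_atom Lambda s),
         Naf (Atom (Defeated (spred (conseq s))) (label_term (label s) # pargs (conseq s)))]
      | s. s \<in> rules D}
   \<union> {Atom (Defeated (compl (spred (conseq t)))) (label_term (label s) # pargs (conseq t)) \<longleftarrow>
        [Pos (body_atom Defeasibly t)]
      | t s. t \<in> sd_rules D \<and> s \<in> rules D \<and> spred (conseq s) = compl (spred (conseq t)) \<and>
             (label t, label s) \<in> superior D}"

definition compiled_star ::
  "('f, 'p, 'l) dtheory \<Rightarrow> (('p, 'l) cpred, ('f, 'p, 'l) sym, nat) program" where
  "compiled_star D = compiled_common D
   \<union> {holds_atom Defeasibly (conseq r) \<longleftarrow>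
        [Naf (holds_atom Definitely (compl_lit (conseq r))), Pos (body_atom Defeasibly r),
         Naf (Atom (Overruled (spred (conseq r))) (label_term (label r) # pargs (conseq r)))]
      | r. r \<in> sd_rules D}
   \<union> {Atom (Overruled (spred (conseq r))) (label_term (label r) # pargs (conseq s)) \<longleftarrow>
        [Pos (body_atom Lambda s),
         Naf (Atom (Defeats (spred (conseq r))) [label_term (label r), label_term (label s)])]
      | r s. r \<in> sd_rules D \<and> s \<in> rules D \<and> spred (conseq s) = compl (spred (conseq r))}
   \<union> {Atom (Defeats (spred (conseq r))) [label_term (label r), label_term s] \<longleftarrow> []
      | r s. r \<in> rules D \<and> (label r, s) \<in> superior D}"

end

theory Submission
  imports Defs
begin

text \<open>The atoms true in the well-founded model are the least fixpoint of \<open>\<Gamma> \<circ> \<Gamma>\<close>, where \<open>\<Gamma> X\<close> is the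
  least model of the reduct of the program with respect to \<open>X\<close>. Relate each \<open>definitely\<close>,
  \<open>lambda\<close>, \<open>defeasibly\<close>, \<open>overruled\<close>, \<open>defeated\<close> and \<open>defeats\<close> atom of the metaprogram to its
  compiled form, wherever the compiled program can ask for it. If related atoms agree in \<open>X\<close> and
  \<open>Y\<close>, then by rule induction in either direction they agree in the two least models \<open>\<Gamma> X\<close> and
  \<open>\<Gamma>' Y\<close>; hence they agree in the fixpoints. The inductions work over any signature
  containing the symbols of the programs, and ground literals outside of it are derived by neither
  program.\<close>

section \<open>The alternating fixpoint\<close>

text \<open>The reduct is the Gelfond-Lifschitz reduct. Unfounded sets are left behind at once
  because they mix all predicates of a program, including those without a counterpart in the other
  program. In a least model such predicates are harmless as long as they occur only positively:
  \<open>RuleFact\<close>, \<open>AnyRule\<close>, \<open>Loop\<close> and \<open>Body\<close> never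
  stand under negation, so the relation between the contexts may ignore them, and the rule
  inductions carry extra invariants for them. The obstacle is that a compiled body predicate keeps
  only the arguments of the consequent. Variables that occur in the antecedents alone are lost, so a
  substitution for the metaprogram has to be recovered existentially in one direction and is
  forgotten in the other. A second mismatch is that the metaprogram passes through
  \<open>definitely\<close> where the compiled program repeats facts and strict rules for every
  tag.\<close>

inductive_set reduct_model ::
  "('g \<times> nat) set \<Rightarrow> ('q, 'g, 'v) program \<Rightarrow> ('q, ('g, 'v) trm) atom set
     \<Rightarrow> ('q, ('g, 'v) trm) atom set"
  for \<Sigma> P X where
  step: "c \<in> ground_instances \<Sigma> P \<Longrightarrow>
     \<forall>b. Pos b \<in> set (body c) \<longrightarrow> b \<in> reduct_model \<Sigma> P X \<Longrightarrow>
     \<forall>b. Naf b \<in> set (body c) \<longrightarrow> b \<notin> X \<Longrightarrow> head c \<in> reduct_model \<Sigma> P X"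

lemma reduct_model_antimono:
  assumes "X \<subseteq> Y"
  shows "reduct_model \<Sigma> P Y \<subseteq> reduct_model \<Sigma> P X"
proof
  fix A assume "A \<in> reduct_model \<Sigma> P Y"
  then show "A \<in> reduct_model \<Sigma> P X"
    by induction (use assms in \<open>blast intro: reduct_model.step\<close>)
qed

lemma clause_args_ground_instance:
  "c \<in> ground_instances \<Sigma> P \<Longrightarrow> clause_args c \<subseteq> herbrand_universe \<Sigma>"
  unfolding ground_instances_def by blast

lemma ground_instance_in_herbrand_base:
  assumes "c \<in> ground_instances \<Sigma> P"
  shows "head c \<in> herbrand_base \<Sigma>"
    and "Pos b \<in> set (body c) \<Longrightarrow> b \<in> herbrand_base \<Sigma>"
    and "Naf b \<in> set (body c) \<Longrightarrow> b \<in> herbrand_base \<Sigma>"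
  using clause_args_ground_instance[OF assms]
  by (cases c; force simp: herbrand_base_def)+

lemma reduct_model_subset_herbrand_base: "reduct_model \<Sigma> P X \<subseteq> herbrand_base \<Sigma>"
  by (auto elim!: reduct_model.cases intro: ground_instance_in_herbrand_base)

definition wf_true :: "('g \<times> nat) set \<Rightarrow> ('q, 'g, 'v) program \<Rightarrow> ('q, ('g, 'v) trm) atom set" where
  "wf_true \<Sigma> P = lfp (\<lambda>X. reduct_model \<Sigma> P (reduct_model \<Sigma> P X))"

lemma mono_reduct_model_twice: "mono (\<lambda>X. reduct_model \<Sigma> P (reduct_model \<Sigma> P X))"
  by (intro monoI reduct_model_antimono)

lemma wf_true_unfold: "reduct_model \<Sigma> P (reduct_model \<Sigma> P (wf_true \<Sigma> P)) = wf_true \<Sigma> P"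
  unfolding wf_true_def using lfp_unfold[OF mono_reduct_model_twice] by blast

text \<open>The right-hand side is closed under \<open>wf_step\<close>, so the least fixpoint lies
  below it. For true atoms this is the fixpoint equation of \<open>wf_true\<close>. For false atoms,
  a rule induction shows that no atom derivable against \<open>wf_true\<close> belongs to an
  unfounded set.\<close>

lemma wf_model_subset_alternating:
  "wf_model \<Sigma> P \<subseteq> Pos ` wf_true \<Sigma> P \<union> Naf ` (herbrand_base \<Sigma> - reduct_model \<Sigma> P (wf_true \<Sigma> P))"
    (is "_ \<subseteq> ?I")
  unfolding wf_model_def
proof (rule lfp_lowerbound)
  let ?K = "wf_true \<Sigma> P"
  have "head c \<in> ?K" if c: "c \<in> ground_instances \<Sigma> P" and "set (body c) \<subseteq> ?I" for c
  proof -
    have "head c \<in> reduct_model \<Sigma> P (reduct_model \<Sigma> P ?K)"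
      by (rule reduct_model.step[OF c]) (use that wf_true_unfold[of \<Sigma> P] in auto)
    then show ?thesis by (simp add: wf_true_unfold)
  qed
  moreover have "A \<notin> U" if "A \<in> reduct_model \<Sigma> P ?K" and U: "unfounded \<Sigma> P ?I U" for A U
    using that(1)
  proof induction
    case (step c)
    show ?case
    proof
      assume "head c \<in> U"
      then obtain l where l: "l \<in> set (body c)" "naf_compl l \<in> ?I \<or> l \<in> Pos ` U"
        using U step(1) unfolding unfounded_def by blast
      \<comment> \<open>A positive witness is a premise of the derivation, hence neither false in
        the interpretation nor, by induction, in \<open>U\<close>. A negative witness would need its
        atom in \<open>wf_true\<close>, but the derivation was made against that set.\<close>
      show False by (cases l) (use l step in auto)
    qed
  qed
  ultimately show "wf_step \<Sigma> P ?I \<subseteq> ?I"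
    unfolding wf_step_def immediate_conseq_def unfounded_def by blast
qed

text \<open>The true atoms \<open>?T\<close> of the well-founded model are closed under the double
  reduct operator. Whatever is not derivable against \<open>?T\<close> is unfounded and hence false
  in the model, so each negated premise of the outer derivation holds there, and closure under
  \<open>wf_step\<close> gives the head.\<close>

lemma wf_true_subset_wf_model: "wf_true \<Sigma> P \<subseteq> {A. Pos A \<in> wf_model \<Sigma> P}"
  unfolding wf_true_def
proof (rule lfp_lowerbound)
  let ?W = "wf_model \<Sigma> P"
  let ?T = "{A. Pos A \<in> ?W}"
  let ?U = "herbrand_base \<Sigma> - reduct_model \<Sigma> P ?T"
  have W: "wf_step \<Sigma> P ?W = ?W"
    unfolding wf_model_def by (rule lfp_unfold[OF mono_wf_step, symmetric])
  \<comment> \<open>If the head of a clause is not derivable against \<open>?T\<close>, the clause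
    must be blocked: either some positive premise is not derivable, hence again in
    \<open>?U\<close>, or some negated atom is true in the model.\<close>
  have "unfounded \<Sigma> P ?W ?U"
    unfolding unfounded_def
  proof (intro conjI ballI impI)
    fix c assume c: "c \<in> ground_instances \<Sigma> P" and "head c \<in> ?U"
    then have "(\<exists>b. Pos b \<in> set (body c) \<and> b \<notin> reduct_model \<Sigma> P ?T) \<or>
        (\<exists>b. Naf b \<in> set (body c) \<and> Pos b \<in> ?W)"
      using reduct_model.step[OF c, of ?T] by auto
    then show "\<exists>l\<in>set (body c). naf_compl l \<in> ?W \<or> l \<in> Pos ` ?U"
    proof (elim disjE exE conjE)
      fix b assume b: "Pos b \<in> set (body c)" "b \<notin> reduct_model \<Sigma> P ?T"
      then have "Pos b \<in> Pos ` ?U"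
        using ground_instance_in_herbrand_base(2)[OF c b(1)] by blast
      with b(1) show ?thesis by blast
    qed (metis naf_compl.simps(2))
  qed auto
  then have neg: "Naf A \<in> ?W" if "A \<in> ?U" for A
    using that W unfolding wf_step_def by blast
  show "reduct_model \<Sigma> P (reduct_model \<Sigma> P ?T) \<subseteq> ?T"
  proof
    fix A assume "A \<in> reduct_model \<Sigma> P (reduct_model \<Sigma> P ?T)"
    then show "A \<in> ?T"
    proof induction
      case (step c)
      have "l \<in> ?W" if "l \<in> set (body c)" for l
      proof (cases l)
        case (Pos b)
        with step that show ?thesis by blast
      next
        case (Naf b)
        with step that ground_instance_in_herbrand_base(3)[OF step(1)] have "b \<in> ?U" by blast
        with neg Naf show ?thesis by blast
      qed
      then show ?case
        using step(1) W unfolding wf_step_def immediate_conseq_def by blast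
    qed
  qed
qed

lemma wf_entails_Pos_iff: "P \<Turnstile>\<^sub>W\<^sub>F[\<Sigma>] Pos A \<longleftrightarrow> A \<in> wf_true \<Sigma> P"
  using wf_model_subset_alternating[of \<Sigma> P] wf_true_subset_wf_model[of \<Sigma> P]
  unfolding wf_entails_def by auto

text \<open>The reduct operator reverses the order, so a simulation in one direction between the
  negative contexts yields one in the other direction between the least models.\<close>

definition le_via :: "('a \<times> 'b) set \<Rightarrow> 'a set \<Rightarrow> 'b set \<Rightarrow> bool" where
  "le_via R X Y \<longleftrightarrow> (\<forall>(a, b)\<in>R. a \<in> X \<longrightarrow> b \<in> Y)"

lemma le_viaD: "le_via R X Y \<Longrightarrow> (a, b) \<in> R \<Longrightarrow> a \<in> X \<Longrightarrow> b \<in> Y"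
  unfolding le_via_def by blast

text \<open>Only \<open>P\<close> is iterated. \<open>Q\<close> is held at its fixpoint, which two
  applications of its reduct operator leave unchanged, so \<open>PQ\<close> followed by
  \<open>QP\<close> carries the relation through one double step. Limit stages are unions, and
  \<open>le_via\<close> is preserved by unions on the left.\<close>

lemma wf_true_le_via:
  assumes PQ: "\<And>X Y. le_via R X Y \<Longrightarrow> le_via (R\<inverse>) (reduct_model \<Sigma> Q Y) (reduct_model \<Sigma> P X)"
    and QP: "\<And>X Y. le_via (R\<inverse>) Y X \<Longrightarrow> le_via R (reduct_model \<Sigma> P X) (reduct_model \<Sigma> Q Y)"
  shows "le_via R (wf_true \<Sigma> P) (wf_true \<Sigma> Q)"
  unfolding wf_true_def[of \<Sigma> P]
proof (rule lfp_ordinal_induct[OF mono_reduct_model_twice])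
  fix X assume "le_via R X (wf_true \<Sigma> Q)"
  from QP[OF PQ[OF this]]
  show "le_via R (reduct_model \<Sigma> P (reduct_model \<Sigma> P X)) (wf_true \<Sigma> Q)"
    by (simp add: wf_true_unfold)
next
  fix M assume "\<forall>X\<in>M. le_via R X (wf_true \<Sigma> Q)"
  then show "le_via R (\<Union>M) (wf_true \<Sigma> Q)"
    unfolding le_via_def by blast
qed

lemma wf_entails_Pos_transfer:
  assumes PQ: "\<And>X Y. le_via R X Y \<Longrightarrow> le_via (R\<inverse>) (reduct_model \<Sigma> Q Y) (reduct_model \<Sigma> P X)"
    and QP: "\<And>X Y. le_via (R\<inverse>) Y X \<Longrightarrow> le_via R (reduct_model \<Sigma> P X) (reduct_model \<Sigma> Q Y)"
    and "(A, B) \<in> R"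
  shows "P \<Turnstile>\<^sub>W\<^sub>F[\<Sigma>] Pos A \<longleftrightarrow> Q \<Turnstile>\<^sub>W\<^sub>F[\<Sigma>] Pos B"
proof -
  have "le_via R (wf_true \<Sigma> P) (wf_true \<Sigma> Q)"
    using PQ QP by (rule wf_true_le_via)
  \<comment> \<open>Exchanging \<open>P\<close> with \<open>Q\<close> and \<open>R\<close> with its
    converse turns each of the two hypotheses into the other.\<close>
  moreover have "le_via (R\<inverse>) (wf_true \<Sigma> Q) (wf_true \<Sigma> P)"
    by (rule wf_true_le_via) (use PQ QP in simp_all)
  ultimately show ?thesis
    using assms(3) unfolding wf_entails_Pos_iff le_via_def by blast
qed

section \<open>Clause-wise reasoning about reduct models\<close>

definition inst_atom ::
  "('v \<Rightarrow> ('g, 'v) trm) \<Rightarrow> ('q, ('g, 'v) trm) atom \<Rightarrow> ('q, ('g, 'v) trm) atom" where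
  "inst_atom \<sigma> = map_atom id (subst \<sigma>)"

lemma inst_atom_Atom [simp]: "inst_atom \<sigma> (Atom p ts) = Atom p (map (subst \<sigma>) ts)"
  by (simp add: inst_atom_def)

text \<open>A ground instance needs all its terms in the Herbrand universe, also those of negated
  atoms, about which no derivation says anything. Recording membership in the base literal by
  literal allows a clause to be applied without handling its ground instance.\<close>

definition sat_body ::
  "('g \<times> nat) set \<Rightarrow> ('v \<Rightarrow> ('g, 'v) trm) \<Rightarrow> ('q, ('g, 'v) trm) atom set
     \<Rightarrow> ('q, ('g, 'v) trm) atom set \<Rightarrow> ('q, ('g, 'v) trm) atom naf_lit list \<Rightarrow> bool" where
  "sat_body \<Sigma> \<sigma> N X bs \<longleftrightarrow>
     (\<forall>l\<in>map_naf_lit (inst_atom \<sigma>) ` set bs. case l of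
        Pos b \<Rightarrow> b \<in> herbrand_base \<Sigma> \<and> b \<in> N
      | Naf b \<Rightarrow> b \<in> herbrand_base \<Sigma> \<and> b \<notin> X)"

lemma sat_body_simps [simp]:
  "sat_body \<Sigma> \<sigma> N X []"
  "sat_body \<Sigma> \<sigma> N X (Pos b # bs) \<longleftrightarrow>
     inst_atom \<sigma> b \<in> herbrand_base \<Sigma> \<and> inst_atom \<sigma> b \<in> N \<and> sat_body \<Sigma> \<sigma> N X bs"
  "sat_body \<Sigma> \<sigma> N X (Naf b # bs) \<longleftrightarrow>
     inst_atom \<sigma> b \<in> herbrand_base \<Sigma> \<and> inst_atom \<sigma> b \<notin> X \<and> sat_body \<Sigma> \<sigma> N X bs"
  by (auto simp: sat_body_def)

lemma sat_body_map_Pos [simp]: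
  "sat_body \<Sigma> \<sigma> N X (map (\<lambda>x. Pos (f x)) xs) \<longleftrightarrow>
     (\<forall>x\<in>set xs. inst_atom \<sigma> (f x) \<in> herbrand_base \<Sigma> \<and> inst_atom \<sigma> (f x) \<in> N)"
  by (induction xs) auto

lemma Atom_in_herbrand_base [simp]:
  "Atom p ts \<in> herbrand_base \<Sigma> \<longleftrightarrow> set ts \<subseteq> herbrand_universe \<Sigma>"
  by (simp add: herbrand_base_def)

lemma Fun_in_herbrand_universe [simp]:
  "Fun f ts \<in> herbrand_universe \<Sigma> \<longleftrightarrow> (f, length ts) \<in> \<Sigma> \<and> set ts \<subseteq> herbrand_universe \<Sigma>"
  by (auto intro: herbrand_universe.intros elim: herbrand_universe.cases)

lemma reduct_model_stepI:
  assumes "(h \<longleftarrow> bs) \<in> P" "inst_atom \<sigma> h = A" "A \<in> herbrand_base \<Sigma>"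
    and sat: "sat_body \<Sigma> \<sigma> (reduct_model \<Sigma> P X) X bs"
  shows "A \<in> reduct_model \<Sigma> P X"
proof -
  let ?c = "map_clause id (subst \<sigma>) (h \<longleftarrow> bs)"
  have c: "?c = (A \<longleftarrow> map (map_naf_lit (inst_atom \<sigma>)) bs)"
    using assms(2) by (simp add: inst_atom_def)
  have lits: "case l of
        Pos b \<Rightarrow> b \<in> herbrand_base \<Sigma> \<and> b \<in> reduct_model \<Sigma> P X
      | Naf b \<Rightarrow> b \<in> herbrand_base \<Sigma> \<and> b \<notin> X" if "l \<in> set (body ?c)" for l
    using that sat unfolding c sat_body_def by auto
  have "set_naf_lit l \<subseteq> herbrand_base \<Sigma>" if "l \<in> set (body ?c)" for l
    using lits[OF that] by (cases l) auto
  then have "clause_args ?c \<subseteq> herbrand_universe \<Sigma>"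
    using assms(3) unfolding c clause.set clause.sel
    by (auto simp: herbrand_base_def)
  then have "?c \<in> ground_instances \<Sigma> P"
    using assms(1) unfolding ground_instances_def by blast
  then have "head ?c \<in> reduct_model \<Sigma> P X"
    by (rule reduct_model.step) (auto dest: lits simp del: clause.map)
  then show ?thesis unfolding c by simp
qed

text \<open>Rule induction stated for clauses with a substitution, so that the induction step
  becomes a case distinction over the clause schemas of the program.\<close>

lemma reduct_model_subsetI:
  assumes "\<And>h bs \<sigma>. (h \<longleftarrow> bs) \<in> P \<Longrightarrow> inst_atom \<sigma> h \<in> herbrand_base \<Sigma> \<Longrightarrow>
      sat_body \<Sigma> \<sigma> (reduct_model \<Sigma> P X \<inter> S) X bs \<Longrightarrow> inst_atom \<sigma> h \<in> S"
  shows "reduct_model \<Sigma> P X \<subseteq> S"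
proof
  fix A assume "A \<in> reduct_model \<Sigma> P X"
  then show "A \<in> S"
  proof induction
    case (step c)
    obtain c' \<sigma> where c': "c = map_clause id (subst \<sigma>) c'" "c' \<in> P"
      using step(1) unfolding ground_instances_def by blast
    obtain h bs where hbs: "c' = (h \<longleftarrow> bs)" by (cases c')
    have c: "c = (inst_atom \<sigma> h \<longleftarrow> map (map_naf_lit (inst_atom \<sigma>)) bs)"
      using c' hbs by (simp add: inst_atom_def)
    note base = ground_instance_in_herbrand_base[OF step(1)]
    have "sat_body \<Sigma> \<sigma> (reduct_model \<Sigma> P X \<inter> S) X bs"
      unfolding sat_body_def
    proof
      fix l assume "l \<in> map_naf_lit (inst_atom \<sigma>) ` set bs"
      then have l: "l \<in> set (body c)" using c by simp
      show "case l of
          Pos b \<Rightarrow> b \<in> herbrand_base \<Sigma> \<and> b \<in> reduct_model \<Sigma> P X \<inter> S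
        | Naf b \<Rightarrow> b \<in> herbrand_base \<Sigma> \<and> b \<notin> X"
        by (cases l) (use l step(2,3) base(2,3) in auto)
    qed
    moreover have "inst_atom \<sigma> h \<in> herbrand_base \<Sigma>" using base(1) c by simp
    ultimately have "inst_atom \<sigma> h \<in> S"
      using assms c'(2) unfolding hbs by blast
    then show ?case unfolding c by simp
  qed
qed

section \<open>Terms of the programs\<close>

text \<open>Both programs instantiate a literal to this argument list. Keeping it folded makes the
  metaprogram term \<open>Fun (SPred q) us\<close> and the compiled arguments \<open>us\<close>
  match syntactically.\<close>

definition inst_args :: "(nat \<Rightarrow> ('f, 'p, 'l) pterm) \<Rightarrow> ('f, 'p) lit \<Rightarrow> ('f, 'p, 'l) pterm list" where
  "inst_args \<sigma> l = map (subst \<sigma> \<circ> emb) (args l)"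

lemma map_subst_emb [simp]: "map (subst \<sigma> \<circ> emb) (args l) = inst_args \<sigma> l"
  by (simp add: inst_args_def)

lemma length_inst_args [simp]: "length (inst_args \<sigma> l) = length (args l)"
  unfolding inst_args_def by (rule length_map)

lemma subst_lit_term [simp]: "subst \<sigma> (lit_term l) = Fun (SPred (spred l)) (inst_args \<sigma> l)"
  by (simp add: lit_term_def)

lemma subst_label_term [simp]: "subst \<sigma> (label_term r) = label_term r"
  by (simp add: label_term_def)

lemma label_term_inject [simp]: "label_term r = label_term s \<longleftrightarrow> r = s"
  by (simp add: label_term_def)

lemma subst_nil_term [simp]: "subst \<sigma> nil_term = nil_term"
  by (simp add: nil_term_def)

lemma subst_cons_term [simp]: "subst \<sigma> (cons_term h t) = cons_term (subst \<sigma> h) (subst \<sigma> t)"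
  by (simp add: cons_term_def)

lemma list_term_simps [simp]:
  "list_term [] = nil_term" "list_term (x # xs) = cons_term x (list_term xs)"
  by (simp_all add: list_term_def)

lemma cons_term_neq_nil_term [simp]:
  "cons_term x t \<noteq> nil_term" "nil_term \<noteq> cons_term x t"
  by (simp_all add: nil_term_def cons_term_def)

lemma cons_term_inject [simp]: "cons_term x t = cons_term y u \<longleftrightarrow> x = y \<and> t = u"
  by (simp add: cons_term_def)

lemma list_term_inject [simp]: "list_term xs = list_term ys \<longleftrightarrow> xs = ys"
proof (induction xs arbitrary: ys)
  case Nil
  then show ?case by (cases ys) auto
next
  case (Cons x xs)
  then show ?case by (cases ys) auto
qed

lemma cons_term_in_herbrand_universe [simp]:
  "cons_term x t \<in> herbrand_universe \<Sigma> \<longleftrightarrow>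
     (ConsSym, 2) \<in> \<Sigma> \<and> x \<in> herbrand_universe \<Sigma> \<and> t \<in> herbrand_universe \<Sigma>"
  by (simp add: cons_term_def numeral_2_eq_2)

lemma subst_list_term [simp]: "subst \<sigma> (list_term xs) = list_term (map (subst \<sigma>) xs)"
  by (induction xs) auto

lemma spred_vars_inst [simp]: "subst \<sigma> (spred_vars q n) = Fun (SPred q) (map \<sigma> [0..<n])"
  by (simp add: spred_vars_def comp_def)

lemma compl_compl [simp]: "compl (compl q) = q"
  by (cases q) auto

lemma pred_compl [simp]: "pred (compl q) = pred q"
  by (cases q) auto

lemma spred_compl_lit [simp]: "spred (compl_lit l) = compl (spred l)"
  by (simp add: compl_lit_def)

lemma args_compl_lit [simp]: "args (compl_lit l) = args l"
  by (simp add: compl_lit_def)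

lemma inst_args_compl_lit [simp]: "inst_args \<sigma> (compl_lit l) = inst_args \<sigma> l"
  unfolding inst_args_def by (simp only: args_compl_lit)

lemma inst_holds_atom [simp]:
  "inst_atom \<sigma> (holds_atom \<tau> l) = Atom (HoldsC \<tau> (spred l)) (inst_args \<sigma> l)"
  by (simp add: holds_atom_def)

lemma inst_body_atom [simp]:
  "inst_atom \<sigma> (body_atom \<tau> r) = Atom (Body \<tau> (label r)) (inst_args \<sigma> (conseq r))"
  by (simp add: body_atom_def)

abbreviation inst_lit :: "(nat \<Rightarrow> ('f, 'p, 'l) pterm) \<Rightarrow> ('f, 'p) lit \<Rightarrow> ('f, 'p, 'l) pterm" where
  "inst_lit \<sigma> l \<equiv> Fun (SPred (spred l)) (inst_args \<sigma> l)"

lemma subst_comp_lit_term [simp]: "subst \<sigma> \<circ> lit_term = inst_lit \<sigma>"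
  by (simp add: fun_eq_iff)

lemma AnyRule_clauses:
  "(Atom AnyRule [vR, vH, vB] \<longleftarrow> [Pos (Atom StrictOrDefeasible [vR, vH, vB])]) \<in> meta_common"
  "(Atom AnyRule [vR, vH, vB] \<longleftarrow> [Pos (Atom (RuleFact Defeater) [vR, vH, vB])]) \<in> meta_common"
  by (simp_all add: meta_common_def)

lemma StrictOrDefeasible_clauses:
  "(Atom StrictOrDefeasible [vR, vH, vB] \<longleftarrow> [Pos (Atom (RuleFact Strict) [vR, vH, vB])])
     \<in> meta_common"
  "(Atom StrictOrDefeasible [vR, vH, vB] \<longleftarrow> [Pos (Atom (RuleFact Defeasible) [vR, vH, vB])])
     \<in> meta_common"
  by (simp_all add: meta_common_def)

lemma Loop_clauses:
  "(Atom (Loop \<tau>) [nil_term] \<longleftarrow> []) \<in> meta_common"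
  "(Atom (Loop \<tau>) [cons_term vH vT] \<longleftarrow>
     [Pos (Atom (Holds \<tau>) [vH]), Pos (Atom (Loop \<tau>) [vT])]) \<in> meta_common"
  by (simp_all add: meta_common_def)

lemma Holds_clauses:
  "(Atom (Holds Definitely) [vX] \<longleftarrow> [Pos (Atom Fact [vX])]) \<in> meta_common"
  "(Atom (Holds Definitely) [vX] \<longleftarrow>
     [Pos (Atom (RuleFact Strict) [vR, vX, vY]), Pos (Atom (Loop Definitely) [vY])]) \<in> meta_common"
  "(Atom (Holds Lambda) [vX] \<longleftarrow> [Pos (Atom (Holds Definitely) [vX])]) \<in> meta_common"
  "(Atom (Holds Lambda) [vX] \<longleftarrow>
     [Pos (Atom Neg [vX, vX']), Naf (Atom (Holds Definitely) [vX']),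
      Pos (Atom StrictOrDefeasible [vR, vX, vY]), Pos (Atom (Loop Lambda) [vY])]) \<in> meta_common"
  "(Atom (Holds Defeasibly) [vX] \<longleftarrow> [Pos (Atom (Holds Definitely) [vX])]) \<in> meta_common"
  by (simp_all add: meta_common_def)

section \<open>The term language\<close>

text \<open>The signature is bounded only through the clauses shared by both metaprograms, so one
  locale serves both versions. Injectivity of labels recovers a rule from a \<open>Body\<close>
  atom; \<open>superior_labels\<close> keeps the arguments of \<open>Sup\<close> inside the
  universe.\<close>

locale dtheory_signature =
  fixes D :: "('f, 'p, 'l) dtheory" and \<Sigma> :: "(('f, 'p, 'l) sym \<times> nat) set"
  assumes inj_label: "inj_on label (rules D)"
    and superior_labels: "superior D \<subseteq> label ` rules D \<times> label ` rules D"
    and signature: "prog_funs (theory_clauses D \<union> meta_common) \<subseteq> \<Sigma>"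
begin

lemma funs_in_signature:
  assumes "(h \<longleftarrow> bs) \<in> theory_clauses D \<union> meta_common" "t \<in> atom_args h"
  shows "funs t \<subseteq> \<Sigma>"
proof -
  have "t \<in> clause_args (h \<longleftarrow> bs)" using assms(2) by (rule clause.set_intros(3))
  then have "funs t \<subseteq> prog_funs (theory_clauses D \<union> meta_common)"
    unfolding prog_funs_def by (rule order_trans[OF UN_upper UN_upper[OF assms(1)]])
  with signature show ?thesis by (rule subset_trans[rotated])
qed

lemma Fact_clause: "l \<in> facts D \<Longrightarrow> (Atom Fact [lit_term l] \<longleftarrow> []) \<in> theory_clauses D"
  unfolding theory_clauses_def by blast

lemma RuleFact_clause:
  "r \<in> rules D \<Longrightarrow> (Atom (RuleFact (kind r))
     [label_term (label r), lit_term (conseq r), list_term (map lit_term (ants r))] \<longleftarrow> [])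
       \<in> theory_clauses D"
  unfolding theory_clauses_def by blast

lemma Sup_clause:
  "(r, s) \<in> superior D \<Longrightarrow> (Atom Sup [label_term r, label_term s] \<longleftarrow> []) \<in> theory_clauses D"
  unfolding theory_clauses_def by blast

lemma label_in_signature [simp]:
  assumes "r \<in> rules D"
  shows "label_term (label r) \<in> herbrand_universe \<Sigma>"
proof -
  have "funs (label_term (label r)) \<subseteq> \<Sigma>"
    using funs_in_signature[OF UnI1[OF RuleFact_clause[OF assms]]] by simp
  then show ?thesis by (simp add: label_term_def)
qed

lemma nil_term_in_signature [simp]: "nil_term \<in> herbrand_universe \<Sigma>"
proof -
  have "funs nil_term \<subseteq> \<Sigma>"
    using funs_in_signature[OF UnI2[OF Loop_clauses(1)]] by simp
  then show ?thesis by (simp add: nil_term_def)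
qed

lemma cons_term_in_signature [simp]: "(ConsSym, 2) \<in> \<Sigma>"
proof -
  have "funs (cons_term vH vT) \<subseteq> \<Sigma>"
    using funs_in_signature[OF UnI2[OF Loop_clauses(2)]] by simp
  then show ?thesis by (simp add: cons_term_def numeral_2_eq_2)
qed

lemma Neg_clause:
  assumes "(pred q, n) \<in> dtheory_preds D"
  shows "(Atom Neg [spred_vars q n, spred_vars (compl q) n] \<longleftarrow> []) \<in> theory_clauses D"
proof (cases q)
  case (Pr p)
  with assms show ?thesis unfolding theory_clauses_def by simp blast
next
  case (NotPr p)
  with assms show ?thesis unfolding theory_clauses_def by simp blast
qed

text \<open>The \<open>Neg\<close> clauses mention both signs of every predicate of
  \<open>D\<close>. Hence the complement of a consequent is a term of the universe even if
  \<open>D\<close> never mentions it.\<close>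

lemma spred_in_signature:
  assumes "(pred q, n) \<in> dtheory_preds D"
  shows "(SPred q, n) \<in> \<Sigma>"
proof -
  have "funs (spred_vars q n) \<subseteq> \<Sigma>"
    using funs_in_signature[OF UnI1[OF Neg_clause[OF assms]]] by simp
  then show ?thesis by (simp add: spred_vars_def)
qed

lemma dtheory_preds_conseq:
  "r \<in> rules D \<Longrightarrow> (pred (spred (conseq r)), length (args (conseq r))) \<in> dtheory_preds D"
  unfolding dtheory_preds_def dtheory_lits_def by auto

lemma dtheory_preds_facts:
  "l \<in> facts D \<Longrightarrow> (pred (spred l), length (args l)) \<in> dtheory_preds D"
  unfolding dtheory_preds_def dtheory_lits_def by auto

lemma spred_conseq_in_signature [simp]:
  "r \<in> rules D \<Longrightarrow> pred q = pred (spred (conseq r)) \<Longrightarrow> (SPred q, length (args (conseq r))) \<in> \<Sigma>"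
  by (metis spred_in_signature dtheory_preds_conseq)

lemma spred_facts_in_signature [simp]:
  "l \<in> facts D \<Longrightarrow> (SPred (spred l), length (args l)) \<in> \<Sigma>"
  by (metis spred_in_signature dtheory_preds_facts)

lemma list_term_in_signature [simp]:
  "list_term xs \<in> herbrand_universe \<Sigma> \<longleftrightarrow> set xs \<subseteq> herbrand_universe \<Sigma>"
  by (induction xs) auto

lemma sd_rulesD: "r \<in> sd_rules D \<Longrightarrow> r \<in> rules D"
  unfolding sd_rules_def by simp

lemma rule_eqI: "r \<in> rules D \<Longrightarrow> s \<in> rules D \<Longrightarrow> label r = label s \<Longrightarrow> r = s"
  using inj_label by (simp add: inj_on_def)

end

section \<open>Derivations in the metaprograms\<close>

locale meta_reduct = dtheory_signature D \<Sigma>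
  for D :: "('f, 'p, 'l) dtheory" and \<Sigma> +
  fixes M :: "(mpred, ('f, 'p, 'l) sym, nat) program"
    and I :: "(mpred, ('f, 'p, 'l) pterm) atom set"
  assumes meta_subset: "theory_clauses D \<union> meta_common \<subseteq> M"
begin

abbreviation N where "N \<equiv> reduct_model \<Sigma> M I"

lemma N_universe: "Atom p ts \<in> N \<Longrightarrow> t \<in> set ts \<Longrightarrow> t \<in> herbrand_universe \<Sigma>"
  using reduct_model_subset_herbrand_base by fastforce

lemma meta_theory: "c \<in> theory_clauses D \<Longrightarrow> c \<in> M"
  and meta_common: "c \<in> meta_common \<Longrightarrow> c \<in> M"
  using meta_subset by blast+

lemma FactI:
  "l \<in> facts D \<Longrightarrow> inst_lit \<sigma> l \<in> herbrand_universe \<Sigma> \<Longrightarrow> Atom Fact [inst_lit \<sigma> l] \<in> N"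
  by (rule reduct_model_stepI[OF meta_theory[OF Fact_clause], where \<sigma> = \<sigma>]) simp_all

lemma RuleFactI:
  "r \<in> rules D \<Longrightarrow> inst_lit \<sigma> (conseq r) \<in> herbrand_universe \<Sigma> \<Longrightarrow>
   list_term (map (inst_lit \<sigma>) (ants r)) \<in> herbrand_universe \<Sigma> \<Longrightarrow>
   Atom (RuleFact (kind r))
     [label_term (label r), inst_lit \<sigma> (conseq r), list_term (map (inst_lit \<sigma>) (ants r))] \<in> N"
  by (rule reduct_model_stepI[OF meta_theory[OF RuleFact_clause], where \<sigma> = \<sigma>]) simp_all

lemma StrictOrDefeasibleI:
  assumes r: "r \<in> sd_rules D" and "inst_lit \<sigma> (conseq r) \<in> herbrand_universe \<Sigma>"
    and "list_term (map (inst_lit \<sigma>) (ants r)) \<in> herbrand_universe \<Sigma>"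
  shows "Atom StrictOrDefeasible
     [label_term (label r), inst_lit \<sigma> (conseq r), list_term (map (inst_lit \<sigma>) (ants r))] \<in> N"
    (is "Atom _ [?r, ?h, ?b] \<in> N")
proof -
  \<comment> \<open>The indices are those of the abbreviations: 8 is \<open>vH\<close>, 9 is
    \<open>vB\<close>, and the default value serves \<open>vR\<close>. Later clause applications
    build their substitutions in the same way.\<close>
  let ?\<sigma> = "(\<lambda>_. ?r)(8 := ?h, 9 := ?b)"
  note rule = RuleFactI[OF sd_rulesD[OF r] assms(2,3)]
  note [simp] = sd_rulesD[OF r]
  from r consider "kind r = Strict" | "kind r = Defeasible"
    by (auto simp: sd_rules_def)
  then show ?thesis
  proof cases
    case 1
    with rule assms show ?thesis
      by (intro reduct_model_stepI[OF meta_common[OF StrictOrDefeasible_clauses(1)], where \<sigma> = ?\<sigma>])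
         simp_all
  next
    case 2
    with rule assms show ?thesis
      by (intro reduct_model_stepI[OF meta_common[OF StrictOrDefeasible_clauses(2)], where \<sigma> = ?\<sigma>])
         simp_all
  qed
qed

lemma AnyRuleI:
  assumes r: "r \<in> rules D" and "inst_lit \<sigma> (conseq r) \<in> herbrand_universe \<Sigma>"
    and "list_term (map (inst_lit \<sigma>) (ants r)) \<in> herbrand_universe \<Sigma>"
  shows "Atom AnyRule
     [label_term (label r), inst_lit \<sigma> (conseq r), list_term (map (inst_lit \<sigma>) (ants r))] \<in> N"
    (is "Atom _ [?r, ?h, ?b] \<in> N")
proof -
  let ?\<sigma> = "(\<lambda>_. ?r)(8 := ?h, 9 := ?b)"
  show ?thesis
  proof (cases "kind r = Defeater")
    case True
    with RuleFactI[OF assms] assms show ?thesis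
      by (intro reduct_model_stepI[OF meta_common[OF AnyRule_clauses(2)], where \<sigma> = ?\<sigma>]) simp_all
  next
    case False
    then have "r \<in> sd_rules D"
      using r by (cases "kind r") (auto simp: sd_rules_def)
    from StrictOrDefeasibleI[OF this assms(2,3)] assms show ?thesis
      by (intro reduct_model_stepI[OF meta_common[OF AnyRule_clauses(1)], where \<sigma> = ?\<sigma>]) simp_all
  qed
qed

lemma SupI:
  assumes "(r, s) \<in> superior D"
  shows "Atom Sup [label_term r, label_term s] \<in> N"
  using superior_labels assms
  by (intro reduct_model_stepI[OF meta_theory[OF Sup_clause]]) auto

lemma NegI:
  assumes "(pred q, length ts) \<in> dtheory_preds D" "set ts \<subseteq> herbrand_universe \<Sigma>"
  shows "Atom Neg [Fun (SPred q) ts, Fun (SPred (compl q)) ts] \<in> N"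
  using assms spred_in_signature[of q] spred_in_signature[of "compl q"]
  \<comment> \<open>The clause contains the variables 0 to n-1 in order, so the i-th variable is
    sent to the i-th argument.\<close>
  by (intro reduct_model_stepI[OF meta_theory[OF Neg_clause[OF assms(1)]], where \<sigma> = "\<lambda>i. ts ! i"])
     (simp_all add: map_nth)

lemma NegI_conseq:
  assumes "r \<in> rules D" "inst_lit \<sigma> (conseq r) \<in> herbrand_universe \<Sigma>"
  shows "Atom Neg [inst_lit \<sigma> (conseq r),
     Fun (SPred (compl (spred (conseq r)))) (inst_args \<sigma> (conseq r))] \<in> N"
    and "Atom Neg [Fun (SPred (compl (spred (conseq r)))) (inst_args \<sigma> (conseq r)),
     inst_lit \<sigma> (conseq r)] \<in> N"
  using NegI[of "spred (conseq r)" "inst_args \<sigma> (conseq r)"]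
    NegI[of "compl (spred (conseq r))" "inst_args \<sigma> (conseq r)"]
    assms dtheory_preds_conseq[OF assms(1)] by simp_all

lemma LoopI:
  "\<forall>x\<in>set xs. Atom (Holds \<tau>) [x] \<in> N \<Longrightarrow> Atom (Loop \<tau>) [list_term xs] \<in> N"
proof (induction xs)
  case Nil
  show ?case
    by (rule reduct_model_stepI[OF meta_common[OF Loop_clauses(1)[of \<tau>]]]) simp_all
next
  case (Cons x xs)
  then have "x \<in> herbrand_universe \<Sigma>" "list_term xs \<in> herbrand_universe \<Sigma>"
    using N_universe by fastforce+
  with Cons show ?case
    by (intro reduct_model_stepI[OF meta_common[OF Loop_clauses(2)[of \<tau>]],
          where \<sigma> = "(\<lambda>_. x)(5 := list_term xs)"]) simp_all
qed

lemma Definitely_factI: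
  assumes "l \<in> facts D" "inst_lit \<sigma> l \<in> herbrand_universe \<Sigma>"
  shows "Atom (Holds Definitely) [inst_lit \<sigma> l] \<in> N"
  using FactI[OF assms] assms
  by (intro reduct_model_stepI[OF meta_common[OF Holds_clauses(1)], where \<sigma> = "\<lambda>_. inst_lit \<sigma> l"])
     simp_all

lemma Definitely_ruleI:
  assumes "r \<in> rules D" "kind r = Strict" "inst_lit \<sigma> (conseq r) \<in> herbrand_universe \<Sigma>"
    and loop: "Atom (Loop Definitely) [list_term (map (inst_lit \<sigma>) (ants r))] \<in> N"
  shows "Atom (Holds Definitely) [inst_lit \<sigma> (conseq r)] \<in> N"
proof -
  have b: "list_term (map (inst_lit \<sigma>) (ants r)) \<in> herbrand_universe \<Sigma>"
    using N_universe[OF loop] by simp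
  show ?thesis
    using RuleFactI[OF assms(1,3) b] assms b
    by (intro reduct_model_stepI[OF meta_common[OF Holds_clauses(2)],
          where \<sigma> = "(\<lambda>_. inst_lit \<sigma> (conseq r))
            (2 := list_term (map (inst_lit \<sigma>) (ants r)), 3 := label_term (label r))"]) simp_all
qed

text \<open>Counterpart of the compiled clauses that repeat facts and strict rules for all three
  tags.\<close>

lemma Holds_definitelyI:
  assumes "Atom (Holds Definitely) [x] \<in> N"
  shows "Atom (Holds \<tau>) [x] \<in> N"
proof -
  have x: "x \<in> herbrand_universe \<Sigma>"
    using N_universe[OF assms] by simp
  show ?thesis
  proof (cases \<tau>)
    case Definitely
    with assms show ?thesis by simp
  next
    case Lambda
    with assms x show ?thesis
      by (intro reduct_model_stepI[OF meta_common[OF Holds_clauses(3)], where \<sigma> = "\<lambda>_. x"]) simp_all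
  next
    case Defeasibly
    with assms x show ?thesis
      by (intro reduct_model_stepI[OF meta_common[OF Holds_clauses(5)], where \<sigma> = "\<lambda>_. x"]) simp_all
  qed
qed

lemma Lambda_ruleI:
  assumes "r \<in> sd_rules D" "inst_lit \<sigma> (conseq r) \<in> herbrand_universe \<Sigma>"
    and loop: "Atom (Loop Lambda) [list_term (map (inst_lit \<sigma>) (ants r))] \<in> N"
    and "Atom (Holds Definitely)
      [Fun (SPred (compl (spred (conseq r)))) (inst_args \<sigma> (conseq r))] \<notin> I"
  shows "Atom (Holds Lambda) [inst_lit \<sigma> (conseq r)] \<in> N"
proof -
  have b: "list_term (map (inst_lit \<sigma>) (ants r)) \<in> herbrand_universe \<Sigma>"
    using N_universe[OF loop] by simp
  note [simp] = sd_rulesD[OF assms(1)]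
  show ?thesis
    using StrictOrDefeasibleI[OF assms(1,2) b] NegI_conseq(1)[OF sd_rulesD[OF assms(1)] assms(2)]
      assms b
    by (intro reduct_model_stepI[OF meta_common[OF Holds_clauses(4)],
          where \<sigma> = "(\<lambda>_. inst_lit \<sigma> (conseq r))
            (1 := Fun (SPred (compl (spred (conseq r)))) (inst_args \<sigma> (conseq r)),
             2 := list_term (map (inst_lit \<sigma>) (ants r)), 3 := label_term (label r))"]) simp_all
qed

end

section \<open>Derivations in the compiled programs\<close>

lemma compiled_common_clauses:
  "l \<in> facts D \<Longrightarrow> (holds_atom \<tau> l \<longleftarrow> []) \<in> compiled_common D"
  "r \<in> rules D \<Longrightarrow> kind r = Strict \<Longrightarrow>
     (holds_atom \<tau> (conseq r) \<longleftarrow> [Pos (body_atom Definitely r)]) \<in> compiled_common D"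
  "r \<in> sd_rules D \<Longrightarrow>
     (holds_atom Lambda (conseq r) \<longleftarrow>
        [Naf (holds_atom Definitely (compl_lit (conseq r))), Pos (body_atom Lambda r)])
     \<in> compiled_common D"
  unfolding compiled_common_def by blast+

text \<open>Definite bodies are compiled for strict rules alone, whence the side condition.\<close>

lemma body_clause_in_compiled_common:
  assumes "r \<in> rules D" "\<tau> = Definitely \<longrightarrow> kind r = Strict"
  shows "(body_atom \<tau> r \<longleftarrow> map (\<lambda>l. Pos (holds_atom \<tau> l)) (ants r)) \<in> compiled_common D"
proof -
  have "body_clause \<tau> r \<in> compiled_common D"
    using assms unfolding compiled_common_def by (cases \<tau>) blast+
  then show ?thesis by (simp add: body_clause_def)
qed

locale compiled_reduct = dtheory_signature D \<Sigma>
  for D :: "('f, 'p, 'l) dtheory" and \<Sigma> +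
  fixes S :: "(('p, 'l) cpred, ('f, 'p, 'l) sym, nat) program"
    and J :: "(('p, 'l) cpred, ('f, 'p, 'l) pterm) atom set"
  assumes compiled_subset: "compiled_common D \<subseteq> S"
begin

abbreviation K where "K \<equiv> reduct_model \<Sigma> S J"

lemma K_universe: "Atom p ts \<in> K \<Longrightarrow> t \<in> set ts \<Longrightarrow> t \<in> herbrand_universe \<Sigma>"
  using reduct_model_subset_herbrand_base by fastforce

lemma compiled_common: "c \<in> compiled_common D \<Longrightarrow> c \<in> S"
  using compiled_subset by blast

lemma HoldsC_factI:
  "l \<in> facts D \<Longrightarrow> inst_lit \<sigma> l \<in> herbrand_universe \<Sigma> \<Longrightarrow>
   Atom (HoldsC \<tau> (spred l)) (inst_args \<sigma> l) \<in> K"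
  by (rule reduct_model_stepI[OF compiled_common[OF compiled_common_clauses(1)[where l = l and \<tau> = \<tau>]],
        where \<sigma> = \<sigma>]) simp_all

lemma BodyI:
  assumes "r \<in> rules D" "\<tau> = Definitely \<longrightarrow> kind r = Strict"
    and "inst_lit \<sigma> (conseq r) \<in> herbrand_universe \<Sigma>"
    and "\<forall>l\<in>set (ants r). Atom (HoldsC \<tau> (spred l)) (inst_args \<sigma> l) \<in> K"
  shows "Atom (Body \<tau> (label r)) (inst_args \<sigma> (conseq r)) \<in> K"
  by (rule reduct_model_stepI[OF compiled_common[OF body_clause_in_compiled_common[OF assms(1,2)]],
        where \<sigma> = \<sigma>]) (use assms in \<open>auto dest: K_universe\<close>)

lemma HoldsC_strictI:
  assumes "r \<in> rules D" "kind r = Strict"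
    and body: "Atom (Body Definitely (label r)) (inst_args \<sigma> (conseq r)) \<in> K"
  shows "Atom (HoldsC \<tau> (spred (conseq r))) (inst_args \<sigma> (conseq r)) \<in> K"
  by (rule reduct_model_stepI[OF compiled_common[OF compiled_common_clauses(2)[OF assms(1,2), of \<tau>]],
        where \<sigma> = \<sigma>]) (use body in \<open>auto dest: K_universe\<close>)

lemma HoldsC_LambdaI:
  assumes "r \<in> sd_rules D" and body: "Atom (Body Lambda (label r)) (inst_args \<sigma> (conseq r)) \<in> K"
    and "Atom (HoldsC Definitely (compl (spred (conseq r)))) (inst_args \<sigma> (conseq r)) \<notin> J"
  shows "Atom (HoldsC Lambda (spred (conseq r))) (inst_args \<sigma> (conseq r)) \<in> K"
  by (rule reduct_model_stepI[OF compiled_common[OF compiled_common_clauses(3)[OF assms(1)]],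
        where \<sigma> = \<sigma>]) (use assms in \<open>auto dest: K_universe\<close>)

end

section \<open>Simulations between metaprograms and compiled programs\<close>

text \<open>The relation \<open>R\<close> pairs an atom of the metaprogram with its compiled form. It leaves out the
  predicates of the metaprogram that are evaluated away by the compilation, and the body
  predicates; these are described separately by \<open>meta_aux\<close> and \<open>body_derived\<close>.\<close>

fun meta_only :: "mpred \<Rightarrow> bool" where
  "meta_only Fact = True"
| "meta_only (RuleFact k) = True"
| "meta_only Sup = True"
| "meta_only Neg = True"
| "meta_only AnyRule = True"
| "meta_only StrictOrDefeasible = True"
| "meta_only (Loop \<tau>) = True"
| "meta_only _ = False"

text \<open>The clauses common to both versions are simulated once. \<open>R\<close> is determined
  on \<open>Holds\<close> and \<open>HoldsC\<close> and left open on the overruled, defeated and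
  defeats atoms, whose arguments differ between team and individual defeat.\<close>

locale simulation = meta_reduct D \<Sigma> M I + compiled_reduct D \<Sigma> S J
  for D :: "('f, 'p, 'l) dtheory" and \<Sigma> M I S J +
  fixes R :: "((mpred, ('f, 'p, 'l) pterm) atom \<times> (('p, 'l) cpred, ('f, 'p, 'l) pterm) atom) set"
  assumes R_Holds: "(Atom (Holds \<tau>) ts, B) \<in> R \<longleftrightarrow>
      (\<exists>q us. ts = [Fun (SPred q) us] \<and> B = Atom (HoldsC \<tau> q) us)"
    and R_HoldsC: "(A, Atom (HoldsC \<tau> q) us) \<in> R \<longleftrightarrow> A = Atom (Holds \<tau>) [Fun (SPred q) us]"
    and R_meta_only: "meta_only p \<Longrightarrow> (Atom p ts, B) \<notin> R"
    and R_Body: "(A, Atom (Body \<tau> l) us) \<notin> R"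
begin

subsection \<open>From the compiled program to the metaprogram\<close>

text \<open>The substitution is existential because \<open>us\<close> determines only the variables
  of the consequent; those that occur only in the antecedents may take any values for which the list
  of antecedents is derived.\<close>

definition body_derived :: "tag \<Rightarrow> 'l \<Rightarrow> ('f, 'p, 'l) pterm list \<Rightarrow> bool" where
  "body_derived \<tau> l us \<longleftrightarrow> (\<exists>r\<in>rules D. \<exists>\<sigma>. label r = l \<and> us = inst_args \<sigma> (conseq r) \<and>
     Atom (Loop \<tau>) [list_term (map (inst_lit \<sigma>) (ants r))] \<in> N)"

text \<open>Injectivity of labels identifies the hidden rule with \<open>r\<close>. The substitution
  obtained need not be the one that instantiates the clause at hand; they agree on the arguments of
  the consequent, which is all that the head depends on.\<close>

lemma body_derivedD:
  assumes "body_derived \<tau> (label r) us" "r \<in> rules D"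
  obtains \<sigma> where "inst_args \<sigma> (conseq r) = us"
    "Atom (Loop \<tau>) [list_term (map (inst_lit \<sigma>) (ants r))] \<in> N"
  using assms rule_eqI unfolding body_derived_def by blast

definition compiled_sim :: "(('p, 'l) cpred, ('f, 'p, 'l) pterm) atom set" where
  "compiled_sim = {B. (\<forall>A. (A, B) \<in> R \<longrightarrow> A \<in> N) \<and>
     (\<forall>\<tau> l us. B = Atom (Body \<tau> l) us \<longrightarrow> body_derived \<tau> l us)}"

lemma HoldsC_compiled_sim [simp]:
  "Atom (HoldsC \<tau> q) us \<in> compiled_sim \<longleftrightarrow> Atom (Holds \<tau>) [Fun (SPred q) us] \<in> N"
  by (simp add: compiled_sim_def R_HoldsC)

lemma Body_compiled_sim [simp]:
  "Atom (Body \<tau> l) us \<in> compiled_sim \<longleftrightarrow> body_derived \<tau> l us"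
  by (simp add: compiled_sim_def R_Body)

lemma compiled_common_sim:
  assumes le: "le_via R I J"
    and c: "(h \<longleftarrow> bs) \<in> compiled_common D"
    and h: "inst_atom \<sigma> h \<in> herbrand_base \<Sigma>"
    and bs: "sat_body \<Sigma> \<sigma> (X \<inter> compiled_sim) J bs"
  shows "inst_atom \<sigma> h \<in> compiled_sim"
proof -
  consider (fact) \<tau> l where "l \<in> facts D" "h = holds_atom \<tau> l"
    | (strict) \<tau> r where "r \<in> rules D" "kind r = Strict" "h = holds_atom \<tau> (conseq r)"
        "bs = [Pos (body_atom Definitely r)]"
    | (lambda) r where "r \<in> sd_rules D" "h = holds_atom Lambda (conseq r)"
        "bs = [Naf (holds_atom Definitely (compl_lit (conseq r))), Pos (body_atom Lambda r)]"
    | (body) \<tau> r where "r \<in> rules D" "h = body_atom \<tau> r"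
        "bs = map (\<lambda>l. Pos (holds_atom \<tau> l)) (ants r)"
    using c unfolding compiled_common_def body_clause_def by auto
  then show ?thesis
  proof cases
    case fact
    with h Definitely_factI show ?thesis by (simp add: Holds_definitelyI)
  next
    case strict
    with bs obtain \<sigma>' where \<sigma>': "inst_args \<sigma>' (conseq r) = inst_args \<sigma> (conseq r)"
      "Atom (Loop Definitely) [list_term (map (inst_lit \<sigma>') (ants r))] \<in> N"
      by (auto elim: body_derivedD)
    with strict h Definitely_ruleI[of r \<sigma>'] show ?thesis by (simp add: Holds_definitelyI)
  next
    case lambda
    note r = sd_rulesD[OF lambda(1)]
    with lambda bs obtain \<sigma>' where \<sigma>': "inst_args \<sigma>' (conseq r) = inst_args \<sigma> (conseq r)"
      "Atom (Loop Lambda) [list_term (map (inst_lit \<sigma>') (ants r))] \<in> N"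
      by (auto elim: body_derivedD)
    \<comment> \<open>If \<open>I\<close> contained this atom, \<open>le\<close> would put its
      compiled form into \<open>J\<close>, against the negated premise of the clause.\<close>
    have "Atom (Holds Definitely)
        [Fun (SPred (compl (spred (conseq r)))) (inst_args \<sigma> (conseq r))] \<notin> I"
      using lambda bs le_viaD[OF le] R_HoldsC by fastforce
    with lambda(1,2) \<sigma>' h r Lambda_ruleI[of r \<sigma>'] show ?thesis by simp
  next
    case body
    with bs have "Atom (Loop \<tau>) [list_term (map (inst_lit \<sigma>) (ants r))] \<in> N"
      by (intro LoopI) simp
    with body show ?thesis by (auto simp: body_derived_def)
  qed
qed

lemma le_via_compiled_sim: "K \<subseteq> compiled_sim \<Longrightarrow> le_via (R\<inverse>) K N"
  unfolding le_via_def compiled_sim_def by blast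

subsection \<open>From the metaprogram to the compiled program\<close>

text \<open>A single substitution for both the consequent and the antecedents keeps the two tied
  together while a rule instance passes through \<open>StrictOrDefeasible\<close> and
  \<open>AnyRule\<close>.\<close>

definition rule_terms :: "('f, 'p, 'l) rule \<Rightarrow> ('f, 'p, 'l) pterm list \<Rightarrow> bool" where
  "rule_terms r ts \<longleftrightarrow> (\<exists>\<sigma>. ts =
     [label_term (label r), inst_lit \<sigma> (conseq r), list_term (map (inst_lit \<sigma>) (ants r))])"

text \<open>\<open>Holds Definitely\<close> is strengthened to all three tags: the metaprogram
  derives \<open>lambda\<close> and \<open>defeasibly\<close> from \<open>definitely\<close>, while
  the compiled program has no such clause and must derive each tag anew from the fact or strict
  rule. For \<open>Loop\<close>, the list is decoded and a claim is made only about its literal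
  members.\<close>

fun meta_aux :: "mpred \<Rightarrow> ('f, 'p, 'l) pterm list \<Rightarrow> bool" where
  "meta_aux Fact ts = (\<exists>l\<in>facts D. \<exists>\<sigma>. ts = [inst_lit \<sigma> l])"
| "meta_aux (RuleFact k) ts = (\<exists>r\<in>rules D. kind r = k \<and> rule_terms r ts)"
| "meta_aux Sup ts = (\<exists>(r, s)\<in>superior D. ts = [label_term r, label_term s])"
| "meta_aux Neg ts = (\<exists>q us. ts = [Fun (SPred q) us, Fun (SPred (compl q)) us])"
| "meta_aux AnyRule ts = (\<exists>r\<in>rules D. rule_terms r ts)"
| "meta_aux StrictOrDefeasible ts = (\<exists>r\<in>sd_rules D. rule_terms r ts)"
| "meta_aux (Loop \<tau>) ts = (\<forall>xs q us. ts = [list_term xs] \<longrightarrow> Fun (SPred q) us \<in> set xs \<longrightarrow>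
     Atom (HoldsC \<tau> q) us \<in> K)"
| "meta_aux (Holds Definitely) ts = (\<forall>q us \<tau>. ts = [Fun (SPred q) us] \<longrightarrow>
     Atom (HoldsC \<tau> q) us \<in> K)"
| "meta_aux _ ts = True"

definition meta_sim :: "(mpred, ('f, 'p, 'l) pterm) atom set" where
  "meta_sim = {A. (\<forall>B. (A, B) \<in> R \<longrightarrow> B \<in> K) \<and> (\<forall>p ts. A = Atom p ts \<longrightarrow> meta_aux p ts)}"

lemma meta_only_meta_sim [simp]:
  "meta_only p \<Longrightarrow> Atom p ts \<in> meta_sim \<longleftrightarrow> meta_aux p ts"
  by (simp add: meta_sim_def R_meta_only)

lemma Holds_meta_sim [simp]:
  "Atom (Holds \<tau>) [x] \<in> meta_sim \<longleftrightarrow>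
     (\<forall>q us \<tau>'. x = Fun (SPred q) us \<longrightarrow> \<tau> = Definitely \<or> \<tau>' = \<tau> \<longrightarrow> Atom (HoldsC \<tau>' q) us \<in> K)"
  by (cases \<tau>) (auto simp: meta_sim_def R_Holds)

lemma theory_clauses_sim:
  assumes c: "(h \<longleftarrow> bs) \<in> theory_clauses D"
  shows "inst_atom \<sigma> h \<in> meta_sim"
proof -
  consider (fact) l where "l \<in> facts D" "h = Atom Fact [lit_term l]"
    | (rule) r where "r \<in> rules D" "h = Atom (RuleFact (kind r))
        [label_term (label r), lit_term (conseq r), list_term (map lit_term (ants r))]"
    | (sup) r s where "(r, s) \<in> superior D" "h = Atom Sup [label_term r, label_term s]"
    | (neg) p n where "h = Atom Neg [spred_vars (Pr p) n, spred_vars (NotPr p) n]"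
    | (neg') p n where "h = Atom Neg [spred_vars (NotPr p) n, spred_vars (Pr p) n]"
    using c unfolding theory_clauses_def by auto
  then show ?thesis
  proof cases
    case rule
    then show ?thesis by (auto simp: rule_terms_def)
  qed auto
qed

text \<open>Folds a rule atom and a \<open>Loop\<close> atom back into one body predicate. The loop
  invariant supplies every instantiated antecedent, so the body clause fires, and the substitution
  returned instantiates the consequent as the compiled head clauses require.\<close>

lemma Body_of_rule_terms:
  assumes r: "r \<in> rules D" "\<tau> = Definitely \<longrightarrow> kind r = Strict"
    and terms: "rule_terms r [l, Fun (SPred q) us, ys]" "Fun (SPred q) us \<in> herbrand_universe \<Sigma>"
    and loop: "Atom (Loop \<tau>) [ys] \<in> meta_sim"
  shows "\<exists>\<sigma>. l = label_term (label r) \<and> q = spred (conseq r) \<and> us = inst_args \<sigma> (conseq r) \<and>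
     Atom (Body \<tau> (label r)) us \<in> K"
proof -
  obtain \<sigma> where \<sigma>: "l = label_term (label r)" "q = spred (conseq r)"
    "us = inst_args \<sigma> (conseq r)" "ys = list_term (map (inst_lit \<sigma>) (ants r))"
    using terms(1) unfolding rule_terms_def by auto
  have "Atom (Body \<tau> (label r)) (inst_args \<sigma> (conseq r)) \<in> K"
    using r terms(2) loop \<sigma> by (intro BodyI) (auto simp: image_iff)
  with \<sigma> show ?thesis by blast
qed

lemma meta_common_sim:
  assumes le: "le_via (R\<inverse>) J I"
    and c: "(h \<longleftarrow> bs) \<in> meta_common"
    and h: "inst_atom \<sigma> h \<in> herbrand_base \<Sigma>"
    and bs: "sat_body \<Sigma> \<sigma> (X \<inter> meta_sim) I bs"
  shows "inst_atom \<sigma> h \<in> meta_sim"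
proof -
  consider (any_sd) "h = Atom AnyRule [vR, vH, vB]"
      "bs = [Pos (Atom StrictOrDefeasible [vR, vH, vB])]"
    | (any_defeater) "h = Atom AnyRule [vR, vH, vB]"
      "bs = [Pos (Atom (RuleFact Defeater) [vR, vH, vB])]"
    | (sd_strict) "h = Atom StrictOrDefeasible [vR, vH, vB]"
      "bs = [Pos (Atom (RuleFact Strict) [vR, vH, vB])]"
    | (sd_defeasible) "h = Atom StrictOrDefeasible [vR, vH, vB]"
      "bs = [Pos (Atom (RuleFact Defeasible) [vR, vH, vB])]"
    | (nil) \<tau> where "h = Atom (Loop \<tau>) [nil_term]" "bs = []"
    | (cons) \<tau> where "h = Atom (Loop \<tau>) [cons_term vH vT]"
        "bs = [Pos (Atom (Holds \<tau>) [vH]), Pos (Atom (Loop \<tau>) [vT])]"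
    | (fact) "h = Atom (Holds Definitely) [vX]" "bs = [Pos (Atom Fact [vX])]"
    | (strict) "h = Atom (Holds Definitely) [vX]"
        "bs = [Pos (Atom (RuleFact Strict) [vR, vX, vY]), Pos (Atom (Loop Definitely) [vY])]"
    | (definitely) \<tau> where "h = Atom (Holds \<tau>) [vX]" "bs = [Pos (Atom (Holds Definitely) [vX])]"
    | (lambda) "h = Atom (Holds Lambda) [vX]"
        "bs = [Pos (Atom Neg [vX, vX']), Naf (Atom (Holds Definitely) [vX']),
           Pos (Atom StrictOrDefeasible [vR, vX, vY]), Pos (Atom (Loop Lambda) [vY])]"
    using c unfolding meta_common_def Un_iff insert_iff mem_Collect_eq empty_iff clause.inject
    by (elim disjE exE conjE FalseE) (rule that, assumption, assumption)+
  then show ?thesis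
  proof cases
    case any_sd
    with bs show ?thesis by (auto simp: sd_rules_def)
  next
    case any_defeater
    with bs show ?thesis by (auto simp: sd_rules_def)
  next
    case sd_strict
    with bs show ?thesis by (auto simp: sd_rules_def)
  next
    case sd_defeasible
    with bs show ?thesis by (auto simp: sd_rules_def)
  next
    case nil
    have "nil_term = list_term xs \<longleftrightarrow> xs = []" for xs :: "('f, 'p, 'l) pterm list"
      by (cases xs) auto
    with nil show ?thesis by simp
  next
    case cons
    \<comment> \<open>Variables 8 and 5 are \<open>vH\<close> and \<open>vT\<close>. Every decoding
      of the longer list splits into its head and a decoding of its tail, so the invariants of the
      two premises combine.\<close>
    have "cons_term (\<sigma> 8) (\<sigma> 5) = list_term xs \<longleftrightarrow> (\<exists>ys. xs = \<sigma> 8 # ys \<and> \<sigma> 5 = list_term ys)" for xs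
      by (cases xs) auto
    with cons bs show ?thesis by auto
  next
    case fact
    with bs h show ?thesis by (auto intro!: HoldsC_factI)
  next
    case strict
    have "Atom (HoldsC \<tau> q) us \<in> K" if x: "\<sigma> 0 = Fun (SPred q) us" for \<tau> q us
    proof -
      obtain r where r: "r \<in> rules D" "kind r = Strict"
        "rule_terms r [\<sigma> 3, Fun (SPred q) us, \<sigma> 2]"
        using strict bs x by auto
      with strict bs h x Body_of_rule_terms[of r Definitely "\<sigma> 3" q us "\<sigma> 2"] show ?thesis
        by (auto intro: HoldsC_strictI)
    qed
    with strict show ?thesis by simp
  next
    case definitely
    \<comment> \<open>The strengthened invariant for \<open>Holds Definitely\<close> already
      provides the required tag.\<close>
    with bs show ?thesis by auto
  next
    case lambda
    have "Atom (HoldsC Lambda q) us \<in> K" if x: "\<sigma> 0 = Fun (SPred q) us" for q us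
    proof -
      obtain r where r: "r \<in> sd_rules D" "rule_terms r [\<sigma> 3, Fun (SPred q) us, \<sigma> 2]"
        using lambda bs x by auto
      have "\<sigma> 1 = Fun (SPred (compl q)) us"
        using lambda bs x by auto
      \<comment> \<open>The \<open>Neg\<close> premise has fixed \<open>vX'\<close> as the
        complement. Were its compiled atom in \<open>J\<close>, \<open>le\<close> would put the
        negated premise of the metaprogram clause into \<open>I\<close>.\<close>
      then have "Atom (HoldsC Definitely (compl q)) us \<notin> J"
        using lambda bs le_viaD[OF le] R_HoldsC by fastforce
      with r lambda bs h x Body_of_rule_terms[of r Lambda "\<sigma> 3" q us "\<sigma> 2"] sd_rulesD[OF r(1)]
      show ?thesis
        by (auto intro: HoldsC_LambdaI)
    qed
    with lambda show ?thesis by simp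
  qed
qed

lemma le_via_meta_sim: "N \<subseteq> meta_sim \<Longrightarrow> le_via R N K"
  unfolding le_via_def meta_sim_def by blast

end

definition holds_corr ::
  "((mpred, ('f, 'p, 'l) pterm) atom \<times> (('p, 'l) cpred, ('f, 'p, 'l) pterm) atom) set" where
  "holds_corr = {(Atom (Holds \<tau>) [Fun (SPred q) us], Atom (HoldsC \<tau> q) us) | \<tau> q us. True}"

section \<open>Team defeat\<close>

text \<open>The metaprogram also derives \<open>defeated\<close> atoms whose label does not name a rule for the
  literal; they have no compiled form, but no \<open>overruled\<close> instance depends on them.\<close>

definition par_corr :: "('f, 'p, 'l) dtheory \<Rightarrow>
  ((mpred, ('f, 'p, 'l) pterm) atom \<times> (('p, 'l) cpred, ('f, 'p, 'l) pterm) atom) set" where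
  "par_corr D = holds_corr
   \<union> {(Atom MOverruled [Fun (SPred q) us], Atom (Overruled q) us) | q us. True}
   \<union> {(Atom MDefeated [label_term (label s), Fun (SPred (spred (conseq s))) us],
       Atom (Defeated (spred (conseq s))) (label_term (label s) # us)) | s us. s \<in> rules D}"

lemma meta_par_clauses:
  "(Atom (Holds Defeasibly) [vX] \<longleftarrow>
     [Pos (Atom Neg [vX, vX']), Naf (Atom (Holds Definitely) [vX']),
      Pos (Atom StrictOrDefeasible [vR, vX, vY]), Pos (Atom (Loop Defeasibly) [vY]),
      Naf (Atom MOverruled [vX])]) \<in> meta_par D"
  "(Atom MOverruled [vX] \<longleftarrow>
     [Pos (Atom Neg [vX, vX']), Pos (Atom AnyRule [vS, vX', vU]),
      Pos (Atom (Loop Lambda) [vU]), Naf (Atom MDefeated [vS, vX'])]) \<in> meta_par D"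
  "(Atom MDefeated [vS, vX'] \<longleftarrow>
     [Pos (Atom Neg [vX, vX']), Pos (Atom Sup [vT, vS]),
      Pos (Atom StrictOrDefeasible [vT, vX, vV]), Pos (Atom (Loop Defeasibly) [vV])]) \<in> meta_par D"
  by (simp_all add: meta_par_def)

lemma compiled_clauses:
  "r \<in> sd_rules D \<Longrightarrow>
     (holds_atom Defeasibly (conseq r) \<longleftarrow>
        [Naf (holds_atom Definitely (compl_lit (conseq r))), Pos (body_atom Defeasibly r),
         Naf (Atom (Overruled (spred (conseq r))) (pargs (conseq r)))]) \<in> compiled D"
  "s \<in> rules D \<Longrightarrow>
     (Atom (Overruled (compl (spred (conseq s)))) (pargs (conseq s)) \<longleftarrow>
        [Pos (body_atom Lambda s),
         Naf (Atom (Defeated (spred (conseq s))) (label_term (label s) # pargs (conseq s)))])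
     \<in> compiled D"
  "t \<in> sd_rules D \<Longrightarrow> s \<in> rules D \<Longrightarrow> spred (conseq s) = compl (spred (conseq t)) \<Longrightarrow>
   (label t, label s) \<in> superior D \<Longrightarrow>
     (Atom (Defeated (compl (spred (conseq t)))) (label_term (label s) # pargs (conseq t)) \<longleftarrow>
        [Pos (body_atom Defeasibly t)]) \<in> compiled D"
  unfolding compiled_def by blast+

locale par_simulation = meta_reduct D \<Sigma> "meta_par D" I + compiled_reduct D \<Sigma> "compiled D" J
  for D :: "('f, 'p, 'l) dtheory" and \<Sigma> I J
begin

sublocale simulation D \<Sigma> "meta_par D" I "compiled D" J "par_corr D"
proof
  show "(Atom p ts, B) \<notin> par_corr D" if "meta_only p" for p ts B
    using that by (auto simp: par_corr_def holds_corr_def)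
qed (auto simp: par_corr_def holds_corr_def)

lemma Overruled_compiled_sim [simp]:
  "Atom (Overruled q) us \<in> compiled_sim \<longleftrightarrow> Atom MOverruled [Fun (SPred q) us] \<in> N"
  unfolding compiled_sim_def by (auto simp: par_corr_def holds_corr_def)

lemma Defeated_compiled_sim [simp]:
  "s \<in> rules D \<Longrightarrow> Atom (Defeated (spred (conseq s))) (label_term (label s) # us) \<in> compiled_sim \<longleftrightarrow>
     Atom MDefeated [label_term (label s), Fun (SPred (spred (conseq s))) us] \<in> N"
  unfolding compiled_sim_def by (auto simp: par_corr_def holds_corr_def)

lemma MOverruled_meta_sim [simp]:
  "Atom MOverruled [x] \<in> meta_sim \<longleftrightarrow>
     (\<forall>q us. x = Fun (SPred q) us \<longrightarrow> Atom (Overruled q) us \<in> K)"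
  unfolding meta_sim_def by (auto simp: par_corr_def holds_corr_def)

lemma MDefeated_meta_sim [simp]:
  "Atom MDefeated [l, x] \<in> meta_sim \<longleftrightarrow>
     (\<forall>s us. s \<in> rules D \<longrightarrow> l = label_term (label s) \<longrightarrow> x = Fun (SPred (spred (conseq s))) us \<longrightarrow>
        Atom (Defeated (spred (conseq s))) (label_term (label s) # us) \<in> K)"
  unfolding meta_sim_def by (auto simp: par_corr_def holds_corr_def)

lemma MOverruled_corr: "(Atom MOverruled [Fun (SPred q) us], Atom (Overruled q) us) \<in> par_corr D"
  by (simp add: par_corr_def)

lemma MDefeated_corr:
  "s \<in> rules D \<Longrightarrow> (Atom MDefeated [label_term (label s), Fun (SPred (spred (conseq s))) us],
     Atom (Defeated (spred (conseq s))) (label_term (label s) # us)) \<in> par_corr D"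
  unfolding par_corr_def by blast

lemma Defeasibly_ruleI:
  assumes "r \<in> sd_rules D" and x: "inst_lit \<sigma> (conseq r) \<in> herbrand_universe \<Sigma>"
    and loop: "Atom (Loop Defeasibly) [list_term (map (inst_lit \<sigma>) (ants r))] \<in> N"
    and "Atom (Holds Definitely)
      [Fun (SPred (compl (spred (conseq r)))) (inst_args \<sigma> (conseq r))] \<notin> I"
    and "Atom MOverruled [inst_lit \<sigma> (conseq r)] \<notin> I"
  shows "Atom (Holds Defeasibly) [inst_lit \<sigma> (conseq r)] \<in> N"
proof -
  have b: "list_term (map (inst_lit \<sigma>) (ants r)) \<in> herbrand_universe \<Sigma>"
    using N_universe[OF loop] by simp
  note [simp] = sd_rulesD[OF assms(1)]
  show ?thesis
    using StrictOrDefeasibleI[OF assms(1) x b] NegI_conseq(1)[OF sd_rulesD[OF assms(1)] x] assms b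
    by (intro reduct_model_stepI[OF meta_par_clauses(1),
          where \<sigma> = "(\<lambda>_. inst_lit \<sigma> (conseq r))
            (1 := Fun (SPred (compl (spred (conseq r)))) (inst_args \<sigma> (conseq r)),
             2 := list_term (map (inst_lit \<sigma>) (ants r)), 3 := label_term (label r))"]) simp_all
qed

lemma MOverruledI:
  assumes "s \<in> rules D" and x: "inst_lit \<sigma> (conseq s) \<in> herbrand_universe \<Sigma>"
    and loop: "Atom (Loop Lambda) [list_term (map (inst_lit \<sigma>) (ants s))] \<in> N"
    and "Atom MDefeated [label_term (label s), inst_lit \<sigma> (conseq s)] \<notin> I"
  shows "Atom MOverruled [Fun (SPred (compl (spred (conseq s)))) (inst_args \<sigma> (conseq s))] \<in> N"
proof -
  have b: "list_term (map (inst_lit \<sigma>) (ants s)) \<in> herbrand_universe \<Sigma>"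
    using N_universe[OF loop] by simp
  show ?thesis
    using AnyRuleI[OF assms(1) x b] NegI_conseq(2)[OF assms(1) x] assms b
    by (intro reduct_model_stepI[OF meta_par_clauses(2),
          where \<sigma> = "(\<lambda>_. inst_lit \<sigma> (conseq s))
            (0 := Fun (SPred (compl (spred (conseq s)))) (inst_args \<sigma> (conseq s)),
             4 := label_term (label s), 6 := list_term (map (inst_lit \<sigma>) (ants s)))"]) simp_all
qed

text \<open>The arguments of the defeated literal come from \<open>t\<close>; \<open>s\<close>
  contributes only its label. Neither program compares these arguments with the consequent of
  \<open>s\<close>.\<close>

lemma MDefeatedI:
  assumes "t \<in> sd_rules D" "s \<in> rules D" "(label t, label s) \<in> superior D"
    and x: "inst_lit \<sigma> (conseq t) \<in> herbrand_universe \<Sigma>"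
    and loop: "Atom (Loop Defeasibly) [list_term (map (inst_lit \<sigma>) (ants t))] \<in> N"
  shows "Atom MDefeated [label_term (label s),
     Fun (SPred (compl (spred (conseq t)))) (inst_args \<sigma> (conseq t))] \<in> N"
proof -
  have b: "list_term (map (inst_lit \<sigma>) (ants t)) \<in> herbrand_universe \<Sigma>"
    using N_universe[OF loop] by simp
  note [simp] = sd_rulesD[OF assms(1)]
  show ?thesis
    using StrictOrDefeasibleI[OF assms(1) x b] NegI_conseq(1)[OF sd_rulesD[OF assms(1)] x]
      SupI[OF assms(3)] assms b
    by (intro reduct_model_stepI[OF meta_par_clauses(3),
          where \<sigma> = "(\<lambda>_. inst_lit \<sigma> (conseq t))
            (1 := Fun (SPred (compl (spred (conseq t)))) (inst_args \<sigma> (conseq t)),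
             4 := label_term (label s), 5 := label_term (label t),
             7 := list_term (map (inst_lit \<sigma>) (ants t)))"]) simp_all
qed

lemma compiled_subset_sim:
  assumes le: "le_via (par_corr D) I J"
  shows "K \<subseteq> compiled_sim"
proof (rule reduct_model_subsetI)
  fix h bs \<sigma>
  assume c: "(h \<longleftarrow> bs) \<in> compiled D"
    and h: "inst_atom \<sigma> h \<in> herbrand_base \<Sigma>"
    and bs: "sat_body \<Sigma> \<sigma> (K \<inter> compiled_sim) J bs"
  consider (common) "(h \<longleftarrow> bs) \<in> compiled_common D"
    | (defeasibly) r where "r \<in> sd_rules D" "h = holds_atom Defeasibly (conseq r)"
        "bs = [Naf (holds_atom Definitely (compl_lit (conseq r))), Pos (body_atom Defeasibly r),
           Naf (Atom (Overruled (spred (conseq r))) (pargs (conseq r)))]"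
    | (overruled) s where "s \<in> rules D"
        "h = Atom (Overruled (compl (spred (conseq s)))) (pargs (conseq s))"
        "bs = [Pos (body_atom Lambda s),
           Naf (Atom (Defeated (spred (conseq s))) (label_term (label s) # pargs (conseq s)))]"
    | (defeated) t s where "t \<in> sd_rules D" "s \<in> rules D"
        "spred (conseq s) = compl (spred (conseq t))" "(label t, label s) \<in> superior D"
        "h = Atom (Defeated (compl (spred (conseq t)))) (label_term (label s) # pargs (conseq t))"
        "bs = [Pos (body_atom Defeasibly t)]"
    using c unfolding compiled_def by auto
  then show "inst_atom \<sigma> h \<in> compiled_sim"
  proof cases
    case common
    from le this h bs show ?thesis by (rule compiled_common_sim)
  next
    case defeasibly
    note r = sd_rulesD[OF defeasibly(1)]
    with defeasibly bs obtain \<sigma>' where \<sigma>': "inst_args \<sigma>' (conseq r) = inst_args \<sigma> (conseq r)"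
      "Atom (Loop Defeasibly) [list_term (map (inst_lit \<sigma>') (ants r))] \<in> N"
      by (auto elim: body_derivedD)
    have "Atom (Holds Definitely)
        [Fun (SPred (compl (spred (conseq r)))) (inst_args \<sigma> (conseq r))] \<notin> I"
      using defeasibly bs le_viaD[OF le] R_HoldsC by fastforce
    moreover have "Atom MOverruled [inst_lit \<sigma> (conseq r)] \<notin> I"
      using defeasibly bs le_viaD[OF le MOverruled_corr] by auto
    ultimately show ?thesis
      using defeasibly(1,2) \<sigma>' h r Defeasibly_ruleI[of r \<sigma>'] by simp
  next
    case overruled
    with bs obtain \<sigma>' where \<sigma>': "inst_args \<sigma>' (conseq s) = inst_args \<sigma> (conseq s)"
      "Atom (Loop Lambda) [list_term (map (inst_lit \<sigma>') (ants s))] \<in> N"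
      by (auto elim: body_derivedD)
    \<comment> \<open>Label and literal belong to the same rule \<open>s\<close>, so this
      \<open>MDefeated\<close> atom does have a compiled partner.\<close>
    have "Atom MDefeated [label_term (label s), inst_lit \<sigma> (conseq s)] \<notin> I"
      using overruled bs le_viaD[OF le MDefeated_corr[OF overruled(1)]] by auto
    then show ?thesis
      using overruled(1,2) \<sigma>' h MOverruledI[of s \<sigma>'] by simp
  next
    case defeated
    note t = sd_rulesD[OF defeated(1)]
    with defeated bs obtain \<sigma>' where \<sigma>': "inst_args \<sigma>' (conseq t) = inst_args \<sigma> (conseq t)"
      "Atom (Loop Defeasibly) [list_term (map (inst_lit \<sigma>') (ants t))] \<in> N"
      by (auto elim: body_derivedD)
    then have "Atom MDefeated [label_term (label s),
        Fun (SPred (spred (conseq s))) (inst_args \<sigma> (conseq t))] \<in> N"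
      using defeated(1-5) h t MDefeatedI[of t s \<sigma>'] by simp
    with defeated show ?thesis
      using Defeated_compiled_sim[of s] by simp
  qed
qed

lemma HoldsC_DefeasiblyI:
  assumes "r \<in> sd_rules D" and body: "Atom (Body Defeasibly (label r)) (inst_args \<sigma> (conseq r)) \<in> K"
    and "Atom (HoldsC Definitely (compl (spred (conseq r)))) (inst_args \<sigma> (conseq r)) \<notin> J"
    and "Atom (Overruled (spred (conseq r))) (inst_args \<sigma> (conseq r)) \<notin> J"
  shows "Atom (HoldsC Defeasibly (spred (conseq r))) (inst_args \<sigma> (conseq r)) \<in> K"
  by (rule reduct_model_stepI[OF compiled_clauses(1)[OF assms(1)], where \<sigma> = \<sigma>])
     (use assms in \<open>auto dest: K_universe\<close>)

lemma OverruledI: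
  assumes "s \<in> rules D" and body: "Atom (Body Lambda (label s)) (inst_args \<sigma> (conseq s)) \<in> K"
    and "Atom (Defeated (spred (conseq s))) (label_term (label s) # inst_args \<sigma> (conseq s)) \<notin> J"
  shows "Atom (Overruled (compl (spred (conseq s)))) (inst_args \<sigma> (conseq s)) \<in> K"
  by (rule reduct_model_stepI[OF compiled_clauses(2)[OF assms(1)], where \<sigma> = \<sigma>])
     (use assms in \<open>auto dest: K_universe\<close>)

lemma DefeatedI:
  assumes "t \<in> sd_rules D" "s \<in> rules D" "spred (conseq s) = compl (spred (conseq t))"
    "(label t, label s) \<in> superior D"
    and body: "Atom (Body Defeasibly (label t)) (inst_args \<sigma> (conseq t)) \<in> K"
  shows "Atom (Defeated (compl (spred (conseq t)))) (label_term (label s) # inst_args \<sigma> (conseq t))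
     \<in> K"
  by (rule reduct_model_stepI[OF compiled_clauses(3)[OF assms(1-4)], where \<sigma> = \<sigma>])
     (use assms in \<open>auto dest: K_universe\<close>)

lemma meta_subset_sim:
  assumes le: "le_via ((par_corr D)\<inverse>) J I"
  shows "N \<subseteq> meta_sim"
proof (rule reduct_model_subsetI)
  fix h bs \<sigma>
  assume c: "(h \<longleftarrow> bs) \<in> meta_par D"
    and h: "inst_atom \<sigma> h \<in> herbrand_base \<Sigma>"
    and bs: "sat_body \<Sigma> \<sigma> (N \<inter> meta_sim) I bs"
  consider (clauses) "(h \<longleftarrow> bs) \<in> theory_clauses D"
    | (common) "(h \<longleftarrow> bs) \<in> meta_common"
    | (defeasibly) "h = Atom (Holds Defeasibly) [vX]"
        "bs = [Pos (Atom Neg [vX, vX']), Naf (Atom (Holds Definitely) [vX']),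
           Pos (Atom StrictOrDefeasible [vR, vX, vY]), Pos (Atom (Loop Defeasibly) [vY]),
           Naf (Atom MOverruled [vX])]"
    | (overruled) "h = Atom MOverruled [vX]"
        "bs = [Pos (Atom Neg [vX, vX']), Pos (Atom AnyRule [vS, vX', vU]),
           Pos (Atom (Loop Lambda) [vU]), Naf (Atom MDefeated [vS, vX'])]"
    | (defeated) "h = Atom MDefeated [vS, vX']"
        "bs = [Pos (Atom Neg [vX, vX']), Pos (Atom Sup [vT, vS]),
           Pos (Atom StrictOrDefeasible [vT, vX, vV]), Pos (Atom (Loop Defeasibly) [vV])]"
    using c unfolding meta_par_def by auto
  then show "inst_atom \<sigma> h \<in> meta_sim"
  proof cases
    case clauses
    then show ?thesis by (rule theory_clauses_sim)
  next
    case common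
    from le this h bs show ?thesis by (rule meta_common_sim)
  next
    case defeasibly
    have "Atom (HoldsC Defeasibly q) us \<in> K" if x: "\<sigma> 0 = Fun (SPred q) us" for q us
    proof -
      obtain r where r: "r \<in> sd_rules D" "rule_terms r [\<sigma> 3, Fun (SPred q) us, \<sigma> 2]"
        using defeasibly bs x by auto
      have "\<sigma> 1 = Fun (SPred (compl q)) us"
        using defeasibly bs x by auto
      then have "Atom (HoldsC Definitely (compl q)) us \<notin> J"
        using defeasibly bs le_viaD[OF le] R_HoldsC by fastforce
      moreover have "Atom (Overruled q) us \<notin> J"
        using defeasibly bs x le_viaD[OF le converseI[OF MOverruled_corr]] by auto
      ultimately show ?thesis
        using r defeasibly bs h x sd_rulesD[OF r(1)]
          Body_of_rule_terms[of r Defeasibly "\<sigma> 3" q us "\<sigma> 2"]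
        by (auto intro: HoldsC_DefeasiblyI)
    qed
    with defeasibly show ?thesis by simp
  next
    case overruled
    have "Atom (Overruled q) us \<in> K" if x: "\<sigma> 0 = Fun (SPred q) us" for q us
    proof -
      have x': "\<sigma> 1 = Fun (SPred (compl q)) us"
        using overruled bs x by auto
      then obtain s where s: "s \<in> rules D" "rule_terms s [\<sigma> 4, Fun (SPred (compl q)) us, \<sigma> 6]"
        using overruled bs by auto
      obtain \<sigma>' where \<sigma>': "\<sigma> 4 = label_term (label s)" "compl q = spred (conseq s)"
        "us = inst_args \<sigma>' (conseq s)" "Atom (Body Lambda (label s)) us \<in> K"
        using Body_of_rule_terms[OF s(1) _ s(2), of Lambda] overruled bs x' by auto
      have "Atom (Defeated (spred (conseq s))) (label_term (label s) # us) \<notin> J"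
        using overruled bs x' \<sigma>' le_viaD[OF le converseI[OF MDefeated_corr[OF s(1)]]] by auto
      with OverruledI[OF s(1), of \<sigma>'] \<sigma>' show ?thesis
        by (metis compl_compl)
    qed
    with overruled show ?thesis by simp
  next
    case defeated
    \<comment> \<open>The invariant asks only about labels of rules whose consequent has the
      predicate of the literal; other derived atoms satisfy it vacuously.\<close>
    have "Atom (Defeated (spred (conseq s))) (label_term (label s) # us) \<in> K"
      if s: "s \<in> rules D" "\<sigma> 4 = label_term (label s)"
        "\<sigma> 1 = Fun (SPred (spred (conseq s))) us" for s us
    proof -
      \<comment> \<open>Here the head fixes \<open>vX'\<close> and \<open>vX\<close> has to be
        found. \<open>Neg\<close> can be read backwards because complementation is an
        involution.\<close>
      have x: "\<sigma> 0 = Fun (SPred (compl (spred (conseq s)))) us"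
        using defeated bs s by auto
      then obtain t where t: "t \<in> sd_rules D"
        "rule_terms t [\<sigma> 5, Fun (SPred (compl (spred (conseq s)))) us, \<sigma> 7]"
        using defeated bs by auto
      obtain \<sigma>' where \<sigma>': "\<sigma> 5 = label_term (label t)" "compl (spred (conseq s)) = spred (conseq t)"
        "us = inst_args \<sigma>' (conseq t)" "Atom (Body Defeasibly (label t)) us \<in> K"
        using Body_of_rule_terms[OF sd_rulesD[OF t(1)] _ t(2), of Defeasibly] defeated bs x by auto
      have "(label t, label s) \<in> superior D"
        using defeated bs s \<sigma>' by auto
      with DefeatedI[OF t(1) s(1), of \<sigma>'] \<sigma>' show ?thesis
        by (metis compl_compl)
    qed
    with defeated show ?thesis by simp
  qed
qed

end

section \<open>Individual defeat\<close>

text \<open>The label in the head of the \<open>overruled\<close> clause of the metaprogram is not bound by the body,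
  so the clause also applies to labels of rules for other literals.\<close>

definition star_corr :: "('f, 'p, 'l) dtheory \<Rightarrow>
  ((mpred, ('f, 'p, 'l) pterm) atom \<times> (('p, 'l) cpred, ('f, 'p, 'l) pterm) atom) set" where
  "star_corr D = holds_corr
   \<union> {(Atom MOverruled [label_term (label r), Fun (SPred (spred (conseq r))) us],
       Atom (Overruled (spred (conseq r))) (label_term (label r) # us)) | r us. r \<in> sd_rules D}
   \<union> {(Atom MDefeats [label_term (label r), label_term s],
       Atom (Defeats (spred (conseq r))) [label_term (label r), label_term s])
      | r s. r \<in> rules D}"

lemma meta_par_star_clauses:
  "(Atom (Holds Defeasibly) [vX] \<longleftarrow>
     [Pos (Atom Neg [vX, vX']), Naf (Atom (Holds Definitely) [vX']),
      Pos (Atom StrictOrDefeasible [vR, vX, vY]), Pos (Atom (Loop Defeasibly) [vY]),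
      Naf (Atom MOverruled [vR, vX])]) \<in> meta_par_star D"
  "(Atom MOverruled [vR, vX] \<longleftarrow>
     [Pos (Atom Neg [vX, vX']), Pos (Atom AnyRule [vS, vX', vU]),
      Pos (Atom (Loop Lambda) [vU]), Naf (Atom MDefeats [vR, vS])]) \<in> meta_par_star D"
  "(Atom MDefeats [vR, vS] \<longleftarrow> [Pos (Atom Sup [vR, vS])]) \<in> meta_par_star D"
  by (simp_all add: meta_par_star_def)

lemma compiled_star_clauses:
  "r \<in> sd_rules D \<Longrightarrow>
     (holds_atom Defeasibly (conseq r) \<longleftarrow>
        [Naf (holds_atom Definitely (compl_lit (conseq r))), Pos (body_atom Defeasibly r),
         Naf (Atom (Overruled (spred (conseq r))) (label_term (label r) # pargs (conseq r)))])
     \<in> compiled_star D"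
  "r \<in> sd_rules D \<Longrightarrow> s \<in> rules D \<Longrightarrow> spred (conseq s) = compl (spred (conseq r)) \<Longrightarrow>
     (Atom (Overruled (spred (conseq r))) (label_term (label r) # pargs (conseq s)) \<longleftarrow>
        [Pos (body_atom Lambda s),
         Naf (Atom (Defeats (spred (conseq r))) [label_term (label r), label_term (label s)])])
     \<in> compiled_star D"
  "r \<in> rules D \<Longrightarrow> (label r, l) \<in> superior D \<Longrightarrow>
     (Atom (Defeats (spred (conseq r))) [label_term (label r), label_term l] \<longleftarrow> [])
     \<in> compiled_star D"
  unfolding compiled_star_def by blast+

locale star_simulation =
  meta_reduct D \<Sigma> "meta_par_star D" I + compiled_reduct D \<Sigma> "compiled_star D" J
  for D :: "('f, 'p, 'l) dtheory" and \<Sigma> I J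
begin

sublocale simulation D \<Sigma> "meta_par_star D" I "compiled_star D" J "star_corr D"
proof
  show "(Atom p ts, B) \<notin> star_corr D" if "meta_only p" for p ts B
    using that by (auto simp: star_corr_def holds_corr_def)
qed (auto simp: star_corr_def holds_corr_def)

lemma Overruled_compiled_sim [simp]:
  "r \<in> sd_rules D \<Longrightarrow>
     Atom (Overruled (spred (conseq r))) (label_term (label r) # us) \<in> compiled_sim \<longleftrightarrow>
     Atom MOverruled [label_term (label r), Fun (SPred (spred (conseq r))) us] \<in> N"
  unfolding compiled_sim_def by (auto simp: star_corr_def holds_corr_def)

lemma Defeats_compiled_sim [simp]:
  "r \<in> rules D \<Longrightarrow>
     Atom (Defeats (spred (conseq r))) [label_term (label r), label_term l] \<in> compiled_sim \<longleftrightarrow>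
     Atom MDefeats [label_term (label r), label_term l] \<in> N"
  unfolding compiled_sim_def by (auto simp: star_corr_def holds_corr_def)

lemma MOverruled_meta_sim [simp]:
  "Atom MOverruled [l, x] \<in> meta_sim \<longleftrightarrow>
     (\<forall>r us. r \<in> sd_rules D \<longrightarrow> l = label_term (label r) \<longrightarrow>
        x = Fun (SPred (spred (conseq r))) us \<longrightarrow>
        Atom (Overruled (spred (conseq r))) (label_term (label r) # us) \<in> K)"
  unfolding meta_sim_def by (auto simp: star_corr_def holds_corr_def)

lemma MDefeats_meta_sim [simp]:
  "Atom MDefeats [x, y] \<in> meta_sim \<longleftrightarrow>
     (\<forall>r l. r \<in> rules D \<longrightarrow> x = label_term (label r) \<longrightarrow> y = label_term l \<longrightarrow>
        Atom (Defeats (spred (conseq r))) [label_term (label r), label_term l] \<in> K)"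
  unfolding meta_sim_def by (auto simp: star_corr_def holds_corr_def)

lemma MOverruled_corr:
  "r \<in> sd_rules D \<Longrightarrow> (Atom MOverruled [label_term (label r), Fun (SPred (spred (conseq r))) us],
     Atom (Overruled (spred (conseq r))) (label_term (label r) # us)) \<in> star_corr D"
  unfolding star_corr_def by blast

lemma MDefeats_corr:
  "r \<in> rules D \<Longrightarrow> (Atom MDefeats [label_term (label r), label_term l],
     Atom (Defeats (spred (conseq r))) [label_term (label r), label_term l]) \<in> star_corr D"
  unfolding star_corr_def by blast

lemma Defeasibly_ruleI:
  assumes "r \<in> sd_rules D" and x: "inst_lit \<sigma> (conseq r) \<in> herbrand_universe \<Sigma>"
    and loop: "Atom (Loop Defeasibly) [list_term (map (inst_lit \<sigma>) (ants r))] \<in> N"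
    and "Atom (Holds Definitely)
      [Fun (SPred (compl (spred (conseq r)))) (inst_args \<sigma> (conseq r))] \<notin> I"
    and "Atom MOverruled [label_term (label r), inst_lit \<sigma> (conseq r)] \<notin> I"
  shows "Atom (Holds Defeasibly) [inst_lit \<sigma> (conseq r)] \<in> N"
proof -
  have b: "list_term (map (inst_lit \<sigma>) (ants r)) \<in> herbrand_universe \<Sigma>"
    using N_universe[OF loop] by simp
  note [simp] = sd_rulesD[OF assms(1)]
  show ?thesis
    using StrictOrDefeasibleI[OF assms(1) x b] NegI_conseq(1)[OF sd_rulesD[OF assms(1)] x] assms b
    by (intro reduct_model_stepI[OF meta_par_star_clauses(1),
          where \<sigma> = "(\<lambda>_. inst_lit \<sigma> (conseq r))
            (1 := Fun (SPred (compl (spred (conseq r)))) (inst_args \<sigma> (conseq r)),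
             2 := list_term (map (inst_lit \<sigma>) (ants r)), 3 := label_term (label r))"]) simp_all
qed

text \<open>The label of \<open>r\<close> enters only the head and the negated premise; as the label
  of a rule it lies in the Herbrand universe.\<close>

lemma MOverruledI:
  assumes "r \<in> rules D" "s \<in> rules D"
    and x: "inst_lit \<sigma> (conseq s) \<in> herbrand_universe \<Sigma>"
    and loop: "Atom (Loop Lambda) [list_term (map (inst_lit \<sigma>) (ants s))] \<in> N"
    and "Atom MDefeats [label_term (label r), label_term (label s)] \<notin> I"
  shows "Atom MOverruled [label_term (label r),
     Fun (SPred (compl (spred (conseq s)))) (inst_args \<sigma> (conseq s))] \<in> N"
proof -
  have b: "list_term (map (inst_lit \<sigma>) (ants s)) \<in> herbrand_universe \<Sigma>"
    using N_universe[OF loop] by simp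
  show ?thesis
    using AnyRuleI[OF assms(2) x b] NegI_conseq(2)[OF assms(2) x] assms b
    by (intro reduct_model_stepI[OF meta_par_star_clauses(2),
          where \<sigma> = "(\<lambda>_. inst_lit \<sigma> (conseq s))
            (0 := Fun (SPred (compl (spred (conseq s)))) (inst_args \<sigma> (conseq s)),
             3 := label_term (label r), 4 := label_term (label s),
             6 := list_term (map (inst_lit \<sigma>) (ants s)))"]) simp_all
qed

lemma MDefeatsI:
  assumes "(r, s) \<in> superior D"
  shows "Atom MDefeats [label_term r, label_term s] \<in> N"
  using SupI[OF assms] N_universe[OF SupI[OF assms]]
  by (intro reduct_model_stepI[OF meta_par_star_clauses(3),
        where \<sigma> = "(\<lambda>_. label_term r)(4 := label_term s)"]) simp_all

lemma compiled_subset_sim: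
  assumes le: "le_via (star_corr D) I J"
  shows "K \<subseteq> compiled_sim"
proof (rule reduct_model_subsetI)
  fix h bs \<sigma>
  assume c: "(h \<longleftarrow> bs) \<in> compiled_star D"
    and h: "inst_atom \<sigma> h \<in> herbrand_base \<Sigma>"
    and bs: "sat_body \<Sigma> \<sigma> (K \<inter> compiled_sim) J bs"
  consider (common) "(h \<longleftarrow> bs) \<in> compiled_common D"
    | (defeasibly) r where "r \<in> sd_rules D" "h = holds_atom Defeasibly (conseq r)"
        "bs = [Naf (holds_atom Definitely (compl_lit (conseq r))), Pos (body_atom Defeasibly r),
           Naf (Atom (Overruled (spred (conseq r))) (label_term (label r) # pargs (conseq r)))]"
    | (overruled) r s where "r \<in> sd_rules D" "s \<in> rules D"
        "spred (conseq s) = compl (spred (conseq r))"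
        "h = Atom (Overruled (spred (conseq r))) (label_term (label r) # pargs (conseq s))"
        "bs = [Pos (body_atom Lambda s),
           Naf (Atom (Defeats (spred (conseq r))) [label_term (label r), label_term (label s)])]"
    | (defeats) r l where "r \<in> rules D" "(label r, l) \<in> superior D"
        "h = Atom (Defeats (spred (conseq r))) [label_term (label r), label_term l]"
    using c unfolding compiled_star_def by auto
  then show "inst_atom \<sigma> h \<in> compiled_sim"
  proof cases
    case common
    from le this h bs show ?thesis by (rule compiled_common_sim)
  next
    case defeasibly
    note r = sd_rulesD[OF defeasibly(1)]
    with defeasibly bs obtain \<sigma>' where \<sigma>': "inst_args \<sigma>' (conseq r) = inst_args \<sigma> (conseq r)"
      "Atom (Loop Defeasibly) [list_term (map (inst_lit \<sigma>') (ants r))] \<in> N"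
      by (auto elim: body_derivedD)
    have "Atom (Holds Definitely)
        [Fun (SPred (compl (spred (conseq r)))) (inst_args \<sigma> (conseq r))] \<notin> I"
      using defeasibly bs le_viaD[OF le] R_HoldsC by fastforce
    moreover have "Atom MOverruled [label_term (label r), inst_lit \<sigma> (conseq r)] \<notin> I"
      using defeasibly bs le_viaD[OF le MOverruled_corr[OF defeasibly(1)]] by auto
    ultimately show ?thesis
      using defeasibly(1,2) \<sigma>' h r Defeasibly_ruleI[of r \<sigma>'] by simp
  next
    case overruled
    note r = sd_rulesD[OF overruled(1)]
    from overruled bs obtain \<sigma>' where \<sigma>': "inst_args \<sigma>' (conseq s) = inst_args \<sigma> (conseq s)"
      "Atom (Loop Lambda) [list_term (map (inst_lit \<sigma>') (ants s))] \<in> N"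
      by (auto elim: body_derivedD)
    have "Atom MDefeats [label_term (label r), label_term (label s)] \<notin> I"
      using overruled bs le_viaD[OF le MDefeats_corr[OF r]] by auto
    then show ?thesis
      using overruled(1-4) r \<sigma>' h MOverruledI[of r s \<sigma>'] by simp
  next
    case defeats
    then show ?thesis by (simp add: MDefeatsI)
  qed
qed

lemma HoldsC_DefeasiblyI:
  assumes "r \<in> sd_rules D" and body: "Atom (Body Defeasibly (label r)) (inst_args \<sigma> (conseq r)) \<in> K"
    and "Atom (HoldsC Definitely (compl (spred (conseq r)))) (inst_args \<sigma> (conseq r)) \<notin> J"
    and "Atom (Overruled (spred (conseq r))) (label_term (label r) # inst_args \<sigma> (conseq r)) \<notin> J"
  shows "Atom (HoldsC Defeasibly (spred (conseq r))) (inst_args \<sigma> (conseq r)) \<in> K"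
  by (rule reduct_model_stepI[OF compiled_star_clauses(1)[OF assms(1)], where \<sigma> = \<sigma>])
     (use assms sd_rulesD[OF assms(1)] in \<open>auto dest: K_universe\<close>)

lemma OverruledI:
  assumes "r \<in> sd_rules D" "s \<in> rules D" "spred (conseq s) = compl (spred (conseq r))"
    and body: "Atom (Body Lambda (label s)) (inst_args \<sigma> (conseq s)) \<in> K"
    and "Atom (Defeats (spred (conseq r))) [label_term (label r), label_term (label s)] \<notin> J"
  shows "Atom (Overruled (spred (conseq r))) (label_term (label r) # inst_args \<sigma> (conseq s)) \<in> K"
  by (rule reduct_model_stepI[OF compiled_star_clauses(2)[OF assms(1-3)], where \<sigma> = \<sigma>])
     (use assms sd_rulesD[OF assms(1)] in \<open>auto dest: K_universe\<close>)

lemma DefeatsI: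
  assumes "r \<in> rules D" "(label r, l) \<in> superior D"
  shows "Atom (Defeats (spred (conseq r))) [label_term (label r), label_term l] \<in> K"
  by (rule reduct_model_stepI[OF compiled_star_clauses(3)[OF assms]])
     (use assms superior_labels in auto)

lemma meta_subset_sim:
  assumes le: "le_via ((star_corr D)\<inverse>) J I"
  shows "N \<subseteq> meta_sim"
proof (rule reduct_model_subsetI)
  fix h bs \<sigma>
  assume c: "(h \<longleftarrow> bs) \<in> meta_par_star D"
    and h: "inst_atom \<sigma> h \<in> herbrand_base \<Sigma>"
    and bs: "sat_body \<Sigma> \<sigma> (N \<inter> meta_sim) I bs"
  consider (clauses) "(h \<longleftarrow> bs) \<in> theory_clauses D"
    | (common) "(h \<longleftarrow> bs) \<in> meta_common"
    | (defeasibly) "h = Atom (Holds Defeasibly) [vX]"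
        "bs = [Pos (Atom Neg [vX, vX']), Naf (Atom (Holds Definitely) [vX']),
           Pos (Atom StrictOrDefeasible [vR, vX, vY]), Pos (Atom (Loop Defeasibly) [vY]),
           Naf (Atom MOverruled [vR, vX])]"
    | (overruled) "h = Atom MOverruled [vR, vX]"
        "bs = [Pos (Atom Neg [vX, vX']), Pos (Atom AnyRule [vS, vX', vU]),
           Pos (Atom (Loop Lambda) [vU]), Naf (Atom MDefeats [vR, vS])]"
    | (defeats) "h = Atom MDefeats [vR, vS]" "bs = [Pos (Atom Sup [vR, vS])]"
    using c unfolding meta_par_star_def by auto
  then show "inst_atom \<sigma> h \<in> meta_sim"
  proof cases
    case clauses
    then show ?thesis by (rule theory_clauses_sim)
  next
    case common
    from le this h bs show ?thesis by (rule meta_common_sim)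
  next
    case defeasibly
    have "Atom (HoldsC Defeasibly q) us \<in> K" if x: "\<sigma> 0 = Fun (SPred q) us" for q us
    proof -
      obtain r where r: "r \<in> sd_rules D" "rule_terms r [\<sigma> 3, Fun (SPred q) us, \<sigma> 2]"
        using defeasibly bs x by auto
      \<comment> \<open>Unlike in team defeat, the negated \<open>MOverruled\<close> atom contains
        \<open>vR\<close>. It must be recognized as the label of the applied rule before
        \<open>le\<close> can be used on that atom.\<close>
      obtain \<sigma>' where \<sigma>': "\<sigma> 3 = label_term (label r)" "q = spred (conseq r)"
        "us = inst_args \<sigma>' (conseq r)" "Atom (Body Defeasibly (label r)) us \<in> K"
        using Body_of_rule_terms[OF sd_rulesD[OF r(1)] _ r(2), of Defeasibly] defeasibly bs x
        by auto
      have "\<sigma> 1 = Fun (SPred (compl q)) us"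
        using defeasibly bs x by auto
      then have "Atom (HoldsC Definitely (compl q)) us \<notin> J"
        using defeasibly bs le_viaD[OF le] R_HoldsC by fastforce
      moreover have "Atom (Overruled q) (label_term (label r) # us) \<notin> J"
        using defeasibly bs x \<sigma>' le_viaD[OF le converseI[OF MOverruled_corr[OF r(1)]]] by auto
      ultimately show ?thesis
        using HoldsC_DefeasiblyI[OF r(1), of \<sigma>'] \<sigma>' by simp
    qed
    with defeasibly show ?thesis by simp
  next
    case overruled
    \<comment> \<open>Instances of the unbound \<open>vR\<close> that do not name a strict or
      defeasible rule for this predicate satisfy the invariant vacuously.\<close>
    have "Atom (Overruled (spred (conseq r))) (label_term (label r) # us) \<in> K"
      if r: "r \<in> sd_rules D" "\<sigma> 3 = label_term (label r)"
        and x: "\<sigma> 0 = Fun (SPred (spred (conseq r))) us" for r us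
    proof -
      have x': "\<sigma> 1 = Fun (SPred (compl (spred (conseq r)))) us"
        using overruled bs x by auto
      then obtain s where s: "s \<in> rules D"
        "rule_terms s [\<sigma> 4, Fun (SPred (compl (spred (conseq r)))) us, \<sigma> 6]"
        using overruled bs by auto
      obtain \<sigma>' where \<sigma>': "\<sigma> 4 = label_term (label s)" "compl (spred (conseq r)) = spred (conseq s)"
        "us = inst_args \<sigma>' (conseq s)" "Atom (Body Lambda (label s)) us \<in> K"
        using Body_of_rule_terms[OF s(1) _ s(2), of Lambda] overruled bs x' by auto
      have "Atom (Defeats (spred (conseq r))) [label_term (label r), label_term (label s)] \<notin> J"
        using overruled bs r \<sigma>' le_viaD[OF le converseI[OF MDefeats_corr[OF sd_rulesD[OF r(1)]]]]
        by auto
      with OverruledI[OF r(1) s(1), of \<sigma>'] \<sigma>' show ?thesis by simp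
    qed
    with overruled show ?thesis by simp
  next
    case defeats
    with bs show ?thesis by (auto intro: DefeatsI)
  qed
qed

end

section \<open>Transfer to the well-founded models\<close>

lemma (in dtheory_signature) par_equivalence:
  assumes "(A, B) \<in> par_corr D"
  shows "meta_par D \<Turnstile>\<^sub>W\<^sub>F[\<Sigma>] Pos A \<longleftrightarrow> compiled D \<Turnstile>\<^sub>W\<^sub>F[\<Sigma>] Pos B"
proof (rule wf_entails_Pos_transfer[OF _ _ assms])
  fix I J
  \<comment> \<open>The contexts are arbitrary, so one interpretation yields both one-sided
    transfers.\<close>
  interpret par_simulation D \<Sigma> I J
    by unfold_locales (auto simp: meta_par_def compiled_def)
  show "le_via (par_corr D) I J \<Longrightarrow> le_via ((par_corr D)\<inverse>) K N"
    using compiled_subset_sim by (rule le_via_compiled_sim)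
  show "le_via ((par_corr D)\<inverse>) J I \<Longrightarrow> le_via (par_corr D) N K"
    using meta_subset_sim by (rule le_via_meta_sim)
qed

lemma (in dtheory_signature) star_equivalence:
  assumes "(A, B) \<in> star_corr D"
  shows "meta_par_star D \<Turnstile>\<^sub>W\<^sub>F[\<Sigma>] Pos A \<longleftrightarrow> compiled_star D \<Turnstile>\<^sub>W\<^sub>F[\<Sigma>] Pos B"
proof (rule wf_entails_Pos_transfer[OF _ _ assms])
  fix I J
  interpret star_simulation D \<Sigma> I J
    by unfold_locales (auto simp: meta_par_star_def compiled_star_def)
  show "le_via (star_corr D) I J \<Longrightarrow> le_via ((star_corr D)\<inverse>) K N"
    using compiled_subset_sim by (rule le_via_compiled_sim)
  show "le_via ((star_corr D)\<inverse>) J I \<Longrightarrow> le_via (star_corr D) N K"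
    using meta_subset_sim by (rule le_via_meta_sim)
qed

theorem theorem2:
  fixes D :: "('f, 'p, 'l) dtheory"
    and \<Sigma> :: "(('f, 'p, 'l) sym \<times> nat) set"
    and q :: "'p spred"
    and a :: "('f, nat) trm list"
  assumes "defeasible_theory D"
    and "ground_lit (Lit q a)"
    and "prog_funs (meta_par D) \<union> prog_funs (compiled D) \<subseteq> \<Sigma>"
    and "prog_funs (meta_par_star D) \<union> prog_funs (compiled_star D) \<subseteq> \<Sigma>"
  shows
    "((meta_par D \<Turnstile>\<^sub>W\<^sub>F[\<Sigma>] Pos (Atom (Holds Definitely) [lit_term (Lit q a)]))
        \<longleftrightarrow> (compiled D \<Turnstile>\<^sub>W\<^sub>F[\<Sigma>] Pos (Atom (HoldsC Definitely q) (map emb a)))) \<and>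
     ((meta_par D \<Turnstile>\<^sub>W\<^sub>F[\<Sigma>] Pos (Atom (Holds Lambda) [lit_term (Lit q a)]))
        \<longleftrightarrow> (compiled D \<Turnstile>\<^sub>W\<^sub>F[\<Sigma>] Pos (Atom (HoldsC Lambda q) (map emb a)))) \<and>
     ((meta_par D \<Turnstile>\<^sub>W\<^sub>F[\<Sigma>] Pos (Atom (Holds Defeasibly) [lit_term (Lit q a)]))
        \<longleftrightarrow> (compiled D \<Turnstile>\<^sub>W\<^sub>F[\<Sigma>] Pos (Atom (HoldsC Defeasibly q) (map emb a)))) \<and>
     ((meta_par_star D \<Turnstile>\<^sub>W\<^sub>F[\<Sigma>] Pos (Atom (Holds Definitely) [lit_term (Lit q a)]))
        \<longleftrightarrow> (compiled_star D \<Turnstile>\<^sub>W\<^sub>F[\<Sigma>] Pos (Atom (HoldsC Definitely q) (map emb a)))) \<and>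
     ((meta_par_star D \<Turnstile>\<^sub>W\<^sub>F[\<Sigma>] Pos (Atom (Holds Lambda) [lit_term (Lit q a)]))
        \<longleftrightarrow> (compiled_star D \<Turnstile>\<^sub>W\<^sub>F[\<Sigma>] Pos (Atom (HoldsC Lambda q) (map emb a)))) \<and>
     ((meta_par_star D \<Turnstile>\<^sub>W\<^sub>F[\<Sigma>] Pos (Atom (Holds Defeasibly) [lit_term (Lit q a)]))
        \<longleftrightarrow> (compiled_star D \<Turnstile>\<^sub>W\<^sub>F[\<Sigma>] Pos (Atom (HoldsC Defeasibly q) (map emb a))))"
proof -
  have "theory_clauses D \<union> meta_common \<subseteq> meta_par D"
    unfolding meta_par_def by (rule Un_upper1)
  then have "prog_funs (theory_clauses D \<union> meta_common) \<subseteq> \<Sigma>"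
    using assms(3) unfolding prog_funs_def by blast
  then interpret dtheory_signature D \<Sigma>
    using assms(1) unfolding defeasible_theory_def by unfold_locales blast+
  \<comment> \<open>\<open>holds_corr\<close> puts no condition on the symbols of the arguments, so
    literals outside the universe are covered by the same transfer.\<close>
  have "(Atom (Holds \<tau>) [lit_term (Lit q a)], Atom (HoldsC \<tau> q) (map emb a))
      \<in> par_corr D \<inter> star_corr D"
    for \<tau>
    by (auto simp: par_corr_def star_corr_def holds_corr_def lit_term_def)
  then show ?thesis
    using par_equivalence star_equivalence by blast
qed

end
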